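(* Let $n\ge 2$, let $\Sigma=\mathbb{CP}^1$ with $n+1$ distinct fixed parabolic points $P=\{t_0,\dots,t_n\}$, where $t_0=\infty$, and let $\mathcal V$ be a fixed topological (smooth) complex vector bundle of rank $3$ over $\Sigma$. Fix generic eigenvalues $\{\rho_{i,k}\}_{0\le i\le n,\,1\le k\le 3}$, and let $\mathcal M$ be the moduli space of logarithmic connections $(E,D)$, where $E$ is a holomorphic vector bundle with underlying topological bundle $\mathcal V$ and $D$ is a logarithmic connection on $E$ with parabolic points $P$ whose residue at $t_i$ has eigenvalues $\rho_{i,1},\rho_{i,2},\rho_{i,3}$. Put $N=\tfrac12\dim_{\mathbb C}\mathcal M=3n-5$. Let $\mathcal M^0\subset\mathcal M$ be a dense open subset and $V\subset T^*(\mathbb C\setminus P)^N$ a $\mathrm{Sym}(N)$-invariant affine subvariety such that $$\mathcal M^0=\Big(T^*\big((\mathbb C\setminus P)^N\setminus\Delta\big)\setminus V\Big)\Big/\mathrm{Sym}(N),$$ where $\Delta\subset(\mathbb C\setminus P)^N$ is the subset of points $(q_1,\dots,q_N)$ with $q_{j_1}=q_{j_2}$ for some $j_1\neq j_2$ or $q_j=t_i$ for some $i,j$. Then $\mathcal M^0$ carries a canonical coordinate system consisting of the coordinates $q_j$ ($1\le j\le N$) on the base $(\mathbb C\setminus P)^N/\mathrm{Sym}(N)$ and the coordinates $p_j$ ($1\le j\le N$) on the fiber over $q_j$.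
   Context: Logarithmic connection: for a holomorphic vector bundle $E$ over a compact Riemann surface $\Sigma$ and a finite set $P\subset\Sigma$, a logarithmic connection with parabolic points $P$ is a $\mathbb C$-linear map $D:E\to E\otimes\Omega^1_\Sigma(\log P)$ satisfying $D(\sigma f)=(D\sigma)f+\sigma\otimes df$, where $\Omega^1_\Sigma(\log P)$ is the sheaf of meromorphic 1-forms with at most simple poles at $P$. Near $t_i\in P$, with local coordinate $z_i$ vanishing at $t_i$, $D=d+\frac{\tilde A(z_i)}{z_i}dz_i$ with $\tilde A$ holomorphic; the residue at $t_i$ is $\tilde A(t_i)$. The adjoint orbits of the residues are fixed. Generic eigenvalues (rank $m$): for every integer $1\le l<m$ and all subsets $K_i\subseteq\{1,\dots,m\}$ with $|K_i|=l$ for all $i\in\{0,\dots,n\}$, one has $\sum_{i}\sum_{k\in K_i}\rho_{i,k}\notin\mathbb Z$. Moduli space: $\mathcal M=\{(E,D)\}/\sim$, where $(E,D)\sim(E',D')$ if there is a bundle isomorphism $E\to E'$ conjugating $D$ to $D'$; it is a complex algebraic variety of dimension $2N$, with the Zariski topology. Points of $T^*(\mathbb C\setminus P)^N$ are written $(q_1,\dots,q_N,p_1,\dots,p_N)$, with $(q_j)$ the coordinates on the base and $p_j$ the cotangent fiber coordinate dual to $q_j$ (the canonical coordinates of a cotangent bundle). $\mathrm{Sym}(N)$ acts by simultaneously permuting the pairs $(q_j,p_j)$, so the coordinate system on the quotient is understood as local coordinates, well defined up to simultaneous permutation of the pairs $(q_j,p_j)$. The displayed equality is an identification (isomorphism).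 *)

theory Defs
  imports "HOL-Analysis.Analysis"
begin

section \<open>The Riemann sphere\<close>

text \<open>The sphere is \<open>complex option\<close>, with \<open>None\<close> as the point at infinity. Functions and sections
  over a set \<open>U\<close> are total functions that vanish outside \<open>U\<close>.\<close>

type_synonym sphere = "complex option"

definition sphere_top :: "sphere topology" where
  "sphere_top = Alexandroff_compactification euclidean"

definition chart_inf :: "complex \<Rightarrow> sphere" where
  "chart_inf w = (if w = 0 then None else Some (inverse w))"

definition cut :: "'a set \<Rightarrow> ('a \<Rightarrow> 'b::zero) \<Rightarrow> 'a \<Rightarrow> 'b" where
  "cut U f = (\<lambda>x. if x \<in> U then f x else 0)"

definition supported :: "'a set \<Rightarrow> ('a \<Rightarrow> 'b::zero) \<Rightarrow> bool" where
  "supported U f \<longleftrightarrow> (\<forall>x. x \<notin> U \<longrightarrow> f x = 0)"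

definition hol :: "sphere set \<Rightarrow> (sphere \<Rightarrow> complex) set" where
  "hol U = {f. supported U f \<and>
      (\<lambda>z. f (Some z)) holomorphic_on {z. Some z \<in> U} \<and>
      (\<lambda>w. f (chart_inf w)) holomorphic_on {w. chart_inf w \<in> U}}"

definition cont :: "sphere set \<Rightarrow> (sphere \<Rightarrow> complex) set" where
  "cont U = {f. supported U f \<and> continuous_map (subtopology sphere_top U) euclidean f}"


section \<open>Vector bundles of rank 3\<close>

text \<open>A bundle is given by its sheaf of sections. The fibres are identified with \<open>complex ^ 3\<close> by
  arbitrary, unrelated choices of bases, so that the sections over \<open>U\<close> form a set of (in general
  discontinuous) functions \<open>sphere \<Rightarrow> complex ^ 3\<close>; up to isomorphism every bundle is of this form.
  The parameter \<open>R\<close> is the structure sheaf: \<open>hol\<close> for holomorphic and \<open>cont\<close> for topological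
  bundles. The columns of \<open>\<phi>\<close> are the members of a frame.\<close>

type_synonym sections = "sphere set \<Rightarrow> (sphere \<Rightarrow> complex ^ 3) set"

definition components ::
  "sphere set \<Rightarrow> (sphere \<Rightarrow> complex ^ 3 ^ 3) \<Rightarrow> (sphere \<Rightarrow> complex ^ 3) \<Rightarrow> 3 \<Rightarrow> sphere \<Rightarrow> complex"
  where "components W \<phi> s k = cut W (\<lambda>x. (matrix_inv (\<phi> x) *v s x) $ k)"

definition frame ::
  "(sphere set \<Rightarrow> (sphere \<Rightarrow> complex) set) \<Rightarrow> sections \<Rightarrow> sphere set \<Rightarrow>
    (sphere \<Rightarrow> complex ^ 3 ^ 3) \<Rightarrow> bool" where
  "frame R E U \<phi> \<longleftrightarrow> openin sphere_top U \<and> (\<forall>x\<in>U. invertible (\<phi> x)) \<and>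
    (\<forall>W. openin sphere_top W \<and> W \<subseteq> U \<longrightarrow>
      E W = {s. supported W s \<and> (\<forall>k. components W \<phi> s k \<in> R W)})"

definition vector_bundle ::
  "(sphere set \<Rightarrow> (sphere \<Rightarrow> complex) set) \<Rightarrow> sections \<Rightarrow> bool" where
  "vector_bundle R E \<longleftrightarrow>
    (\<forall>U W s. openin sphere_top U \<and> openin sphere_top W \<and> W \<subseteq> U \<and> s \<in> E U \<longrightarrow> cut W s \<in> E W) \<and>
    (\<forall>U s. openin sphere_top U \<longrightarrow>
      (s \<in> E U \<longleftrightarrow> supported U s \<and>
        (\<forall>x\<in>U. \<exists>W. openin sphere_top W \<and> x \<in> W \<and> W \<subseteq> U \<and> cut W s \<in> E W))) \<and>
    (\<forall>x. \<exists>U \<phi>. x \<in> U \<and> frame R E U \<phi>)"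

definition act :: "(sphere \<Rightarrow> complex ^ 3 ^ 3) \<Rightarrow> (sphere \<Rightarrow> complex ^ 3) \<Rightarrow> sphere \<Rightarrow> complex ^ 3" where
  "act \<psi> s = (\<lambda>x. \<psi> x *v s x)"

definition bundle_iso :: "sections \<Rightarrow> sections \<Rightarrow> (sphere \<Rightarrow> complex ^ 3 ^ 3) \<Rightarrow> bool" where
  "bundle_iso E E' \<psi> \<longleftrightarrow> (\<forall>x. invertible (\<psi> x)) \<and>
    (\<forall>U. openin sphere_top U \<longrightarrow> E' U = act \<psi> ` E U)"

definition underlying_top :: "sections \<Rightarrow> sections" where
  "underlying_top E U = {s. supported U s \<and>
    (\<forall>x\<in>U. \<exists>W \<phi>. x \<in> W \<and> W \<subseteq> U \<and> frame hol E W \<phi> \<and> (\<forall>k. components W \<phi> s k \<in> cont W))}"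


section \<open>Logarithmic connections\<close>

text \<open>The set \<open>P\<close> of parabolic points always contains infinity, so a logarithmic 1-form over \<open>U\<close> is
  determined by its coefficient \<open>a\<close> with respect to \<open>dz\<close> on \<open>U - P\<close>, where \<open>z\<close> is the affine
  coordinate. If \<open>z\<^sub>p\<close> is the local coordinate at \<open>p\<close> (\<open>z - t\<close> for \<open>p = Some t\<close>, and \<open>1/z\<close> for
  \<open>p = None\<close>), then \<open>a dz = (log_factor p * a) dz\<^sub>p / z\<^sub>p\<close>; at infinity \<open>dz = - z\<^sup>2 d(1/z)\<close>.\<close>

definition log_factor :: "sphere \<Rightarrow> sphere \<Rightarrow> complex" where
  "log_factor p x = (case p of Some t \<Rightarrow> the x - t | None \<Rightarrow> - the x)"

definition log_forms :: "sphere set \<Rightarrow> sphere set \<Rightarrow> (sphere \<Rightarrow> complex) set" where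
  "log_forms P U = {a. supported (U - P) a \<and>
    (\<lambda>z. a (Some z)) holomorphic_on {z. Some z \<in> U - P} \<and>
    (\<forall>p\<in>U \<inter> P. \<exists>W h. openin sphere_top W \<and> p \<in> W \<and> W \<subseteq> U \<and> h \<in> hol W \<and>
      (\<forall>x\<in>W - P. h x = log_factor p x * a x))}"

definition log_sections :: "sphere set \<Rightarrow> sections \<Rightarrow> sections" where
  "log_sections P E U = {\<sigma>. supported (U - P) \<sigma> \<and>
    (\<forall>x\<in>U. \<exists>W \<phi>. x \<in> W \<and> W \<subseteq> U \<and> frame hol E W \<phi> \<and>
      (\<forall>k. components (W - P) \<phi> \<sigma> k \<in> log_forms P W))}"

type_synonym operator = "sphere set \<Rightarrow> (sphere \<Rightarrow> complex ^ 3) \<Rightarrow> sphere \<Rightarrow> complex ^ 3"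

definition differential :: "sphere set \<Rightarrow> (sphere \<Rightarrow> complex) \<Rightarrow> sphere \<Rightarrow> complex" where
  "differential V f = cut V (\<lambda>x. deriv (\<lambda>z. f (Some z)) (the x))"

definition log_connection :: "sphere set \<Rightarrow> sections \<Rightarrow> operator \<Rightarrow> bool" where
  "log_connection P E D \<longleftrightarrow>
    (\<forall>U s. openin sphere_top U \<and> s \<in> E U \<longrightarrow> D U s \<in> log_sections P E U) \<and>
    (\<forall>U W s. openin sphere_top U \<and> openin sphere_top W \<and> W \<subseteq> U \<and> s \<in> E U \<longrightarrow>
      D W (cut W s) = cut W (D U s)) \<and>
    (\<forall>U s s'. openin sphere_top U \<and> s \<in> E U \<and> s' \<in> E U \<longrightarrow>
      D U (\<lambda>x. s x + s' x) = (\<lambda>x. D U s x + D U s' x)) \<and>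
    (\<forall>U c s. openin sphere_top U \<and> s \<in> E U \<longrightarrow> D U (\<lambda>x. c *s s x) = (\<lambda>x. c *s D U s x)) \<and>
    (\<forall>U f s. openin sphere_top U \<and> f \<in> hol U \<and> s \<in> E U \<longrightarrow>
      D U (\<lambda>x. f x *s s x) = (\<lambda>x. f x *s D U s x + differential (U - P) f x *s s x))"

text \<open>The matrix \<open>A\<close> of \<open>D = d + A dz\<close> in the frame \<open>\<phi>\<close> over \<open>U\<close>.\<close>

definition conn_matrix ::
  "operator \<Rightarrow> sphere set \<Rightarrow> (sphere \<Rightarrow> complex ^ 3 ^ 3) \<Rightarrow> sphere \<Rightarrow> complex ^ 3 ^ 3" where
  "conn_matrix D U \<phi> x =
    matrix_inv (\<phi> x) ** (\<chi> i j. D U (cut U (\<lambda>y. column j (\<phi> y))) x $ i)"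

text \<open>A residue is a matrix with respect to some frame, hence only determined up to conjugation.\<close>

definition residue_at ::
  "sphere set \<Rightarrow> sections \<Rightarrow> operator \<Rightarrow> sphere \<Rightarrow> complex ^ 3 ^ 3 \<Rightarrow> bool" where
  "residue_at P E D p S \<longleftrightarrow>
    (\<exists>U \<phi> A. p \<in> U \<and> frame hol E U \<phi> \<and> (\<forall>i j. (\<lambda>x. A x $ i $ j) \<in> hol U) \<and>
      (\<forall>x\<in>U - P. \<forall>i j. A x $ i $ j = log_factor p x * conn_matrix D U \<phi> x $ i $ j) \<and>
      S = A p)"

definition adjoint_orbit :: "complex ^ 3 ^ 3 \<Rightarrow> (complex ^ 3 ^ 3) set" where
  "adjoint_orbit C = {S ** C ** matrix_inv S | S. invertible S}"

definition generic_eigenvalues :: "nat \<Rightarrow> nat \<Rightarrow> (nat \<Rightarrow> nat \<Rightarrow> complex) \<Rightarrow> bool" where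
  "generic_eigenvalues m n \<rho> \<longleftrightarrow>
    (\<forall>l K. 1 \<le> l \<and> l < m \<and> (\<forall>i\<le>n. K i \<subseteq> {1..m} \<and> card (K i) = l) \<longrightarrow>
      (\<Sum>i\<le>n. \<Sum>k\<in>K i. \<rho> i k) \<notin> \<int>)"


section \<open>The set of isomorphism classes\<close>

text \<open>The adjoint orbit of the residue at \<open>t i\<close> is that of \<open>C i\<close>.\<close>

definition connections ::
  "nat \<Rightarrow> (nat \<Rightarrow> sphere) \<Rightarrow> sections \<Rightarrow> (nat \<Rightarrow> complex ^ 3 ^ 3) \<Rightarrow> (sections \<times> operator) set" where
  "connections n t \<V> C = {(E, D).
    vector_bundle hol E \<and> (\<exists>\<psi>. bundle_iso (underlying_top E) \<V> \<psi>) \<and>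
    log_connection (t ` {..n}) E D \<and>
    (\<forall>i\<le>n. \<exists>S\<in>adjoint_orbit (C i). residue_at (t ` {..n}) E D (t i) S)}"

definition conn_equiv ::
  "nat \<Rightarrow> (nat \<Rightarrow> sphere) \<Rightarrow> sections \<Rightarrow> (nat \<Rightarrow> complex ^ 3 ^ 3) \<Rightarrow>
    ((sections \<times> operator) \<times> (sections \<times> operator)) set" where
  "conn_equiv n t \<V> C = {((E, D), (E', D')).
    (E, D) \<in> connections n t \<V> C \<and> (E', D') \<in> connections n t \<V> C \<and>
    (\<exists>\<psi>. bundle_iso E E' \<psi> \<and>
      (\<forall>U s. openin sphere_top U \<and> s \<in> E U \<longrightarrow> D' U (act \<psi> s) = act \<psi> (D U s)))}"

definition moduli_set ::
  "nat \<Rightarrow> (nat \<Rightarrow> sphere) \<Rightarrow> sections \<Rightarrow> (nat \<Rightarrow> complex ^ 3 ^ 3) \<Rightarrow> (sections \<times> operator) set set" where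
  "moduli_set n t \<V> C = connections n t \<V> C // conn_equiv n t \<V> C"


section \<open>Complex algebraic varieties\<close>

text \<open>Varieties in the sense of Serre: topological spaces with a sheaf of complex-valued functions
  that have a finite cover by affine ones and are separated. They need not be irreducible.\<close>

record 'a fspace =
  ztop :: "'a topology"
  regs :: "'a set \<Rightarrow> ('a \<Rightarrow> complex) set"

abbreviation points :: "'a fspace \<Rightarrow> 'a set" where
  "points X \<equiv> topspace (ztop X)"

definition function_sheaf :: "'a fspace \<Rightarrow> bool" where
  "function_sheaf X \<longleftrightarrow>
    (\<forall>U W f. openin (ztop X) U \<and> openin (ztop X) W \<and> W \<subseteq> U \<and> f \<in> regs X U \<longrightarrow>
      cut W f \<in> regs X W) \<and>
    (\<forall>U f. openin (ztop X) U \<longrightarrow>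
      (f \<in> regs X U \<longleftrightarrow> supported U f \<and>
        (\<forall>x\<in>U. \<exists>W. openin (ztop X) W \<and> x \<in> W \<and> W \<subseteq> U \<and> cut W f \<in> regs X W)))"

definition open_subspace :: "'a fspace \<Rightarrow> 'a set \<Rightarrow> 'a fspace" where
  "open_subspace X U = \<lparr>ztop = subtopology (ztop X) U, regs = regs X\<rparr>"

definition morphism :: "'a fspace \<Rightarrow> 'b fspace \<Rightarrow> ('a \<Rightarrow> 'b) \<Rightarrow> bool" where
  "morphism X Y \<phi> \<longleftrightarrow> continuous_map (ztop X) (ztop Y) \<phi> \<and>
    (\<forall>V f. openin (ztop Y) V \<and> f \<in> regs Y V \<longrightarrow>
      cut {x \<in> points X. \<phi> x \<in> V} (\<lambda>x. f (\<phi> x)) \<in> regs X {x \<in> points X. \<phi> x \<in> V})"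

definition isomorphism :: "'a fspace \<Rightarrow> 'b fspace \<Rightarrow> ('a \<Rightarrow> 'b) \<Rightarrow> bool" where
  "isomorphism X Y \<phi> \<longleftrightarrow> morphism X Y \<phi> \<and>
    (\<exists>\<psi>. morphism Y X \<psi> \<and> (\<forall>x\<in>points X. \<psi> (\<phi> x) = x) \<and> (\<forall>y\<in>points Y. \<phi> (\<psi> y) = y))"

text \<open>Polynomial functions in the functions of \<open>G\<close>.\<close>

inductive_set polys :: "('a \<Rightarrow> complex) set \<Rightarrow> ('a \<Rightarrow> complex) set" for G where
  const: "(\<lambda>_. c) \<in> polys G"
| gen: "f \<in> G \<Longrightarrow> f \<in> polys G"
| add: "f \<in> polys G \<Longrightarrow> g \<in> polys G \<Longrightarrow> (\<lambda>x. f x + g x) \<in> polys G"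
| mult: "f \<in> polys G \<Longrightarrow> g \<in> polys G \<Longrightarrow> (\<lambda>x. f x * g x) \<in> polys G"

text \<open>The set \<open>X\<close> with the Zariski topology and the regular functions with respect to the coordinate
  functions in \<open>G\<close>.\<close>

definition zariski :: "('a \<Rightarrow> complex) set \<Rightarrow> 'a set \<Rightarrow> 'a fspace" where
  "zariski G X =
    (let T = topology_generated_by {{x \<in> X. f x \<noteq> 0} | f. f \<in> polys G} in
     \<lparr>ztop = T,
      regs = (\<lambda>U. {h. supported U h \<and>
        (\<forall>x\<in>U. \<exists>W. openin T W \<and> x \<in> W \<and> W \<subseteq> U \<and>
          (\<exists>a\<in>polys G. \<exists>b\<in>polys G. \<forall>y\<in>W. b y \<noteq> 0 \<and> h y = a y / b y))})\<rparr>)"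

definition affine_space :: "nat \<Rightarrow> (nat \<Rightarrow> complex) set" where
  "affine_space k = {x. \<forall>i\<ge>k. x i = 0}"

definition coords :: "nat \<Rightarrow> ((nat \<Rightarrow> complex) \<Rightarrow> complex) set" where
  "coords k = {(\<lambda>x. x i) | i. i < k}"

definition algebraic_set :: "nat \<Rightarrow> (nat \<Rightarrow> complex) set \<Rightarrow> bool" where
  "algebraic_set k Z \<longleftrightarrow> (\<exists>F\<subseteq>polys (coords k). Z = {x \<in> affine_space k. \<forall>f\<in>F. f x = 0})"

definition is_affine :: "'a fspace \<Rightarrow> bool" where
  "is_affine X \<longleftrightarrow> (\<exists>k Z \<phi>. algebraic_set k Z \<and> isomorphism X (zariski (coords k) Z) \<phi>)"

definition separated :: "'a fspace \<Rightarrow> bool" where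
  "separated X \<longleftrightarrow> (\<forall>k Z f g. algebraic_set k Z \<and>
      morphism (zariski (coords k) Z) X f \<and> morphism (zariski (coords k) Z) X g \<longrightarrow>
      closedin (ztop (zariski (coords k) Z)) {x \<in> Z. f x = g x})"

definition variety :: "'a fspace \<Rightarrow> bool" where
  "variety X \<longleftrightarrow> function_sheaf X \<and>
    (\<exists>\<U>. finite \<U> \<and> \<Union>\<U> = points X \<and>
      (\<forall>U\<in>\<U>. openin (ztop X) U \<and> is_affine (open_subspace X U))) \<and>
    separated X"

definition irreducible_closed :: "'a topology \<Rightarrow> 'a set \<Rightarrow> bool" where
  "irreducible_closed T S \<longleftrightarrow> closedin T S \<and> S \<noteq> {} \<and>
    (\<forall>A B. closedin T A \<and> closedin T B \<and> S \<subseteq> A \<union> B \<longrightarrow> S \<subseteq> A \<or> S \<subseteq> B)"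

definition irreducible_chain :: "'a topology \<Rightarrow> nat \<Rightarrow> bool" where
  "irreducible_chain T d \<longleftrightarrow>
    (\<exists>c. (\<forall>i\<le>d. irreducible_closed T (c i)) \<and> (\<forall>i<d. c i \<subset> c (Suc i)))"

definition has_dim :: "'a fspace \<Rightarrow> nat \<Rightarrow> bool" where
  "has_dim X d \<longleftrightarrow> irreducible_chain (ztop X) d \<and> \<not> irreducible_chain (ztop X) (Suc d)"

definition quotient_space :: "'a fspace \<Rightarrow> ('a \<Rightarrow> 'b) \<Rightarrow> 'b fspace" where
  "quotient_space X \<pi> =
    \<lparr>ztop = topology (\<lambda>W. W \<subseteq> \<pi> ` points X \<and> openin (ztop X) {x \<in> points X. \<pi> x \<in> W}),
     regs = (\<lambda>W. {h. supported W h \<and>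
       cut {x \<in> points X. \<pi> x \<in> W} (\<lambda>x. h (\<pi> x)) \<in> regs X {x \<in> points X. \<pi> x \<in> W}})\<rparr>"

lemma openin_quotient_space:
  "openin (ztop (quotient_space X \<pi>)) W \<longleftrightarrow>
    W \<subseteq> \<pi> ` points X \<and> openin (ztop X) {x \<in> points X. \<pi> x \<in> W}"
proof -
  have "istopology (\<lambda>W. W \<subseteq> \<pi> ` points X \<and> openin (ztop X) {x \<in> points X. \<pi> x \<in> W})"
    unfolding istopology_def
  proof (intro conjI allI impI)
    fix S T
    assume S: "S \<subseteq> \<pi> ` points X \<and> openin (ztop X) {x \<in> points X. \<pi> x \<in> S}"
      and T: "T \<subseteq> \<pi> ` points X \<and> openin (ztop X) {x \<in> points X. \<pi> x \<in> T}"
    show "S \<inter> T \<subseteq> \<pi> ` points X" using S by blast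
    have "{x \<in> points X. \<pi> x \<in> S \<inter> T} = {x \<in> points X. \<pi> x \<in> S} \<inter> {x \<in> points X. \<pi> x \<in> T}"
      by blast
    then show "openin (ztop X) {x \<in> points X. \<pi> x \<in> S \<inter> T}"
      using S T by (simp add: openin_Int)
  next
    fix K
    assume K: "\<forall>S\<in>K. S \<subseteq> \<pi> ` points X \<and> openin (ztop X) {x \<in> points X. \<pi> x \<in> S}"
    show "\<Union>K \<subseteq> \<pi> ` points X" using K by blast
    have "{x \<in> points X. \<pi> x \<in> \<Union>K} = (\<Union>S\<in>K. {x \<in> points X. \<pi> x \<in> S})"
      by blast
    then show "openin (ztop X) {x \<in> points X. \<pi> x \<in> \<Union>K}"
      using K by (metis (no_types, lifting) imageE openin_Union)
  qed
  then show ?thesis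
    by (simp add: quotient_space_def)
qed


section \<open>The moduli space\<close>

text \<open>An algebraic family of connections over an algebraic set \<open>Z\<close>: the bundles are glued from
  frames \<open>\<phi>\<close> over the affine line and \<open>\<phi>'\<close> over the complement of \<open>0\<close> by a transition matrix \<open>g\<close>
  that is regular on \<open>Z\<close> times the punctured line, and in \<open>\<phi>\<close> the connection matrix is
  \<open>a / \<Prod>i. (z - t i)\<close> with \<open>a\<close> polynomial. By Horrocks' theorem every family over an affine variety
  is of this form locally on the variety. Regularity of the connection matrix near infinity
  holds as every member is logarithmic there and \<open>Z\<close> is reduced.\<close>

definition algebraic_family ::
  "nat \<Rightarrow> (nat \<Rightarrow> sphere) \<Rightarrow> sections \<Rightarrow> (nat \<Rightarrow> complex ^ 3 ^ 3) \<Rightarrow> nat \<Rightarrow> (nat \<Rightarrow> complex) set \<Rightarrow>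
    ((nat \<Rightarrow> complex) \<Rightarrow> sections \<times> operator) \<Rightarrow> bool" where
  "algebraic_family n t \<V> C k Z c \<longleftrightarrow>
    algebraic_set k Z \<and> (\<forall>x\<in>Z. c x \<in> connections n t \<V> C) \<and>
    (\<exists>g a.
      (\<forall>i j. (\<lambda>y. g y $ i $ j) \<in> polys ({(\<lambda>(x, z). x l) | l. l < k} \<union> {snd, (\<lambda>y. inverse (snd y))})) \<and>
      (\<forall>i j. (\<lambda>y. a y $ i $ j) \<in> polys ({(\<lambda>(x, z). x l) | l. l < k} \<union> {snd})) \<and>
      (\<forall>x\<in>Z. \<exists>\<phi> \<phi>'.
        frame hol (fst (c x)) (- {None}) \<phi> \<and> frame hol (fst (c x)) (- {Some 0}) \<phi>' \<and>
        (\<forall>z. z \<noteq> 0 \<longrightarrow> \<phi>' (Some z) = \<phi> (Some z) ** (g (x, z) :: complex ^ 3 ^ 3)) \<and>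
        (\<forall>z. Some z \<notin> t ` {..n} \<longrightarrow> (\<forall>i j.
          conn_matrix (snd (c x)) (- {None}) \<phi> (Some z) $ i $ j =
          (a (x, z) :: complex ^ 3 ^ 3) $ i $ j / (\<Prod>l=1..n. z - the (t l))))))"

text \<open>A coarse moduli space: classifying maps of algebraic families are morphisms, and the variety
  structure is universal with this property. Test varieties \<open>Y\<close> with points in \<open>nat \<Rightarrow> complex\<close>
  suffice, since varieties have at most the cardinality of the continuum.\<close>

definition moduli_space ::
  "nat \<Rightarrow> (nat \<Rightarrow> sphere) \<Rightarrow> sections \<Rightarrow> (nat \<Rightarrow> complex ^ 3 ^ 3) \<Rightarrow>
    (sections \<times> operator) set fspace \<Rightarrow> bool" where
  "moduli_space n t \<V> C M \<longleftrightarrow>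
    variety M \<and> points M = moduli_set n t \<V> C \<and>
    (\<forall>k Z c. algebraic_family n t \<V> C k Z c \<longrightarrow>
      morphism (zariski (coords k) Z) M (\<lambda>x. conn_equiv n t \<V> C `` {c x})) \<and>
    (\<forall>(Y :: (nat \<Rightarrow> complex) fspace) \<eta>. variety Y \<and>
      (\<forall>k Z c. algebraic_family n t \<V> C k Z c \<longrightarrow>
        morphism (zariski (coords k) Z) Y (\<lambda>x. \<eta> (conn_equiv n t \<V> C `` {c x}))) \<longrightarrow>
      morphism M Y \<eta>)"


section \<open>The cotangent bundle and the action of the symmetric group\<close>

definition base :: "sphere set \<Rightarrow> (complex ^ 'N) set" where
  "base P = {q. \<forall>j. Some (q $ j) \<notin> P}"

definition Delta :: "sphere set \<Rightarrow> (complex ^ 'N) set" where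
  "Delta P = {q \<in> base P. (\<exists>j1 j2. j1 \<noteq> j2 \<and> q $ j1 = q $ j2) \<or> (\<exists>j. \<exists>p\<in>P. Some (q $ j) = p)}"

text \<open>The cotangent space at every point of an open subset of \<open>complex ^ 'N\<close> is the dual of
  \<open>complex ^ 'N\<close>; \<open>covec p\<close> is the covector \<open>\<Sum>j. p\<^sub>j dq\<^sub>j\<close>.\<close>

type_synonym 'N cotangent_point = "(complex ^ 'N) \<times> (complex ^ 'N \<Rightarrow> complex)"

definition cotangent :: "(complex ^ 'N) set \<Rightarrow> 'N::finite cotangent_point set" where
  "cotangent B = {(q, \<alpha>). q \<in> B \<and> Vector_Spaces.linear (*s) (*) \<alpha>}"

definition cotangent_coords :: "('N::finite cotangent_point \<Rightarrow> complex) set" where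
  "cotangent_coords = {(\<lambda>(q, \<alpha>). q $ j) | j. True} \<union> {(\<lambda>(q, \<alpha>). \<alpha> (axis j 1)) | j. True}"

definition covec :: "complex ^ 'N::finite \<Rightarrow> complex ^ 'N \<Rightarrow> complex" where
  "covec p = (\<lambda>v. \<Sum>j\<in>UNIV. p $ j * v $ j)"

definition permute :: "('N \<Rightarrow> 'N) \<Rightarrow> complex ^ 'N::finite \<Rightarrow> complex ^ 'N" where
  "permute \<sigma> q = (\<chi> j. q $ \<sigma> j)"

text \<open>The cotangent lift of \<open>permute \<sigma>\<close>; it permutes the pairs \<open>(q\<^sub>j, p\<^sub>j)\<close>.\<close>

definition permute_cotangent ::
  "('N \<Rightarrow> 'N) \<Rightarrow> 'N::finite cotangent_point \<Rightarrow> 'N cotangent_point" where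
  "permute_cotangent \<sigma> = (\<lambda>(q, \<alpha>). (permute \<sigma> q, \<lambda>v. \<alpha> (permute (inv \<sigma>) v)))"

lemma permute_cotangent_covec:
  assumes "bij \<sigma>"
  shows "permute_cotangent \<sigma> (q, covec p) = (permute \<sigma> q, covec (permute \<sigma> p))"
proof -
  have "(\<Sum>j\<in>UNIV. p $ j * v $ inv \<sigma> j) = (\<Sum>j\<in>UNIV. p $ \<sigma> j * v $ j)" for v :: "complex ^ 'a"
    by (rule sum.reindex_bij_betw[symmetric, of \<sigma> UNIV UNIV, THEN trans])
      (use assms in \<open>simp_all add: bij_is_inj\<close>)
  then show ?thesis
    by (simp add: permute_cotangent_def covec_def permute_def)
qed

definition orbit :: "'N::finite cotangent_point \<Rightarrow> 'N cotangent_point set" where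
  "orbit y = {permute_cotangent \<sigma> y | \<sigma>. bij \<sigma>}"


section \<open>Local coordinates\<close>

definition analytic_top :: "'a fspace \<Rightarrow> 'a topology" where
  "analytic_top X = topology_generated_by
    {{x \<in> U. f x \<in> B} | U f B. openin (ztop X) U \<and> f \<in> regs X U \<and> open B}"

text \<open>Holomorphic functions of the first \<open>k\<close> variables, in the form of Osgood's lemma.\<close>

definition holomorphic_several :: "nat \<Rightarrow> (nat \<Rightarrow> complex) set \<Rightarrow> ((nat \<Rightarrow> complex) \<Rightarrow> complex) \<Rightarrow> bool"
  where "holomorphic_several k B H \<longleftrightarrow> open B \<and> continuous_on B H \<and>
    (\<forall>x\<in>B. \<forall>i<k. (\<lambda>z. H (x(i := z))) field_differentiable (at (x i)))"

text \<open>The holomorphic functions of the analytic space associated with \<open>X\<close>: locally, holomorphic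
  functions of finitely many regular functions.\<close>

definition holomorphic_fun :: "'a fspace \<Rightarrow> 'a set \<Rightarrow> ('a \<Rightarrow> complex) \<Rightarrow> bool" where
  "holomorphic_fun X U h \<longleftrightarrow>
    (\<forall>x\<in>U. \<exists>V W k F B H. openin (ztop X) V \<and> openin (analytic_top X) W \<and> x \<in> W \<and> W \<subseteq> U \<inter> V \<and>
      (\<forall>i<k. F i \<in> regs X V) \<and> holomorphic_several k B H \<and>
      (\<forall>y\<in>W. (\<lambda>i. if i < k then F i y else 0) \<in> B \<and>
        h y = H (\<lambda>i. if i < k then F i y else 0)))"

definition complex_differentiable_on ::
  "((complex ^ 'N::finite) \<times> (complex ^ 'N) \<Rightarrow> complex) \<Rightarrow> ((complex ^ 'N) \<times> (complex ^ 'N)) set \<Rightarrow> bool" where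
  "complex_differentiable_on h B \<longleftrightarrow>
    (\<forall>b\<in>B. \<exists>L. (h has_derivative L) (at b) \<and> (\<forall>c u v. L (c *s u, c *s v) = c * L (u, v)))"

text \<open>The pair \<open>(q, p)\<close> maps \<open>U\<close> biholomorphically onto an open set.\<close>

definition local_coordinates ::
  "'a fspace \<Rightarrow> 'a set \<Rightarrow> ('a \<Rightarrow> complex ^ 'N::finite) \<Rightarrow> ('a \<Rightarrow> complex ^ 'N) \<Rightarrow> bool" where
  "local_coordinates X U q p \<longleftrightarrow>
    openin (analytic_top X) U \<and>
    open ((\<lambda>x. (q x, p x)) ` U) \<and>
    homeomorphic_map (subtopology (analytic_top X) U) (top_of_set ((\<lambda>x. (q x, p x)) ` U))
      (\<lambda>x. (q x, p x)) \<and>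
    (\<forall>j. holomorphic_fun X U (\<lambda>x. q x $ j) \<and> holomorphic_fun X U (\<lambda>x. p x $ j)) \<and>
    (\<forall>V f. openin (ztop X) V \<and> f \<in> regs X V \<longrightarrow>
      complex_differentiable_on (\<lambda>b. f (inv_into U (\<lambda>x. (q x, p x)) b))
        ((\<lambda>x. (q x, p x)) ` (U \<inter> V)))"

text \<open>Here \<open>\<Phi>\<close> identifies \<open>X\<close> with a quotient of an open subset of the cotangent bundle; the points
  of the latter are orbits.\<close>

definition canonical_chart ::
  "'a fspace \<Rightarrow> ('a \<Rightarrow> 'N::finite cotangent_point set) \<Rightarrow> 'a set \<Rightarrow>
    ('a \<Rightarrow> complex ^ 'N) \<Rightarrow> ('a \<Rightarrow> complex ^ 'N) \<Rightarrow> bool" where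
  "canonical_chart X \<Phi> U q p \<longleftrightarrow>
    local_coordinates X U q p \<and> (\<forall>x\<in>U. (q x, covec (p x)) \<in> \<Phi> x)"

text \<open>Canonical charts exist around every point, and they are unique up to simultaneous
  permutations of the pairs \<open>(q\<^sub>j, p\<^sub>j)\<close>.\<close>

definition canonical_coordinate_system ::
  "'a fspace \<Rightarrow> ('a \<Rightarrow> 'N::finite cotangent_point set) \<Rightarrow> bool" where
  "canonical_coordinate_system X \<Phi> \<longleftrightarrow>
    (\<forall>x\<in>points X. \<exists>U q p. x \<in> U \<and> canonical_chart X \<Phi> U q p) \<and>
    (\<forall>U q p U' q' p' x. canonical_chart X \<Phi> U q p \<and> canonical_chart X \<Phi> U' q' p' \<and> x \<in> U \<inter> U' \<longrightarrow>
      (\<exists>\<sigma> W. bij \<sigma> \<and> openin (analytic_top X) W \<and> x \<in> W \<and> W \<subseteq> U \<inter> U' \<and>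
        (\<forall>y\<in>W. q' y = permute \<sigma> (q y) \<and> p' y = permute \<sigma> (p y))))"

end

theory Submission
  imports Defs "HOL-Computational_Algebra.Polynomial"
begin

text \<open>The charts are local inverses of the quotient map from the configurations \<open>(q, p)\<close> with
  distinct \<open>q\<^sub>j\<close> to the set of orbits; this map is continuous for the analytic topology and locally
  injective. It is open because the invariants \<open>\<Prod>i. (q\<^sub>i - a\<^sub>j) + s (p\<^sub>i - b\<^sub>j)\<close> control the distance
  of the orbits of \<open>(q, p)\<close> and \<open>(a, b)\<close>. The coordinates are holomorphic by the inverse function
  theorem, applied to the invariants \<open>\<Sum>i. L\<^sub>j(q\<^sub>i)\<close> and \<open>\<Sum>i. p\<^sub>i M\<^sub>j(q\<^sub>i)\<close> for suitable polynomials
  \<open>L\<^sub>j\<close>, \<open>M\<^sub>j\<close>. Two lifts of the same point differ by a permutation, which is locally constant by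
  continuity, as the \<open>q\<^sub>j\<close> are distinct.\<close>

section \<open>Complex differentiability\<close>

text \<open>The analytic topology and the holomorphic functions of the quotient are accessible only
  through regular functions. Openness of the quotient map and holomorphy of its local inverses
  therefore each need explicit symmetric polynomials, and these may be adapted to the point (a, b)
  at hand: products that vanish there, and sums whose Jacobian there is the identity. With one fixed
  set of invariants, a Jacobian would have to be computed and the pairing of each q_j with its p_j
  recovered; interpolation at the distinct a_j and mixing by s avoid both. Derivatives on these
  vector spaces are real, and so is the inverse function theorem. Complex linearity is therefore
  carried along as a homogeneity condition; additivity is already part of real linearity.\<close>

definition complex_differentiable_at ::
  "((complex ^ 'N::finite) \<times> (complex ^ 'N) \<Rightarrow> complex) \<Rightarrow> (complex ^ 'N) \<times> (complex ^ 'N) \<Rightarrow> bool"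
  where "complex_differentiable_at h b \<longleftrightarrow>
    (\<exists>L. (h has_derivative L) (at b) \<and> (\<forall>c u v. L (c *s u, c *s v) = c * L (u, v)))"

lemma complex_differentiable_on_iff:
  "complex_differentiable_on h B \<longleftrightarrow> (\<forall>b\<in>B. complex_differentiable_at h b)"
  by (simp add: complex_differentiable_on_def complex_differentiable_at_def)

lemma complex_differentiable_at_const: "complex_differentiable_at (\<lambda>_. c) b"
  unfolding complex_differentiable_at_def by (rule exI[of _ "\<lambda>_. 0"]) simp

lemma complex_differentiable_at_fst: "complex_differentiable_at (\<lambda>b. fst b $ j) b"
  unfolding complex_differentiable_at_def
  by (rule exI[of _ "\<lambda>b. fst b $ j"])
     (auto intro!: bounded_linear_imp_has_derivative bounded_linear_compose[OF bounded_linear_vec_nth]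
       bounded_linear_fst)

lemma complex_differentiable_at_snd: "complex_differentiable_at (\<lambda>b. snd b $ j) b"
  unfolding complex_differentiable_at_def
  by (rule exI[of _ "\<lambda>b. snd b $ j"])
     (auto intro!: bounded_linear_imp_has_derivative bounded_linear_compose[OF bounded_linear_vec_nth]
       bounded_linear_snd)

lemma complex_differentiable_at_add:
  assumes "complex_differentiable_at f b" "complex_differentiable_at g b"
  shows "complex_differentiable_at (\<lambda>x. f x + g x) b"
proof -
  obtain L K where "(f has_derivative L) (at b)" "(g has_derivative K) (at b)"
    "\<forall>c u v. L (c *s u, c *s v) = c * L (u, v)" "\<forall>c u v. K (c *s u, c *s v) = c * K (u, v)"
    using assms unfolding complex_differentiable_at_def by blast
  then show ?thesis
    unfolding complex_differentiable_at_def
    by (intro exI[of _ "\<lambda>x. L x + K x"] conjI has_derivative_add) (simp_all add: algebra_simps)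
qed

lemma complex_differentiable_at_mult:
  assumes "complex_differentiable_at f b" "complex_differentiable_at g b"
  shows "complex_differentiable_at (\<lambda>x. f x * g x) b"
proof -
  obtain L K where "(f has_derivative L) (at b)" "(g has_derivative K) (at b)"
    "\<forall>c u v. L (c *s u, c *s v) = c * L (u, v)" "\<forall>c u v. K (c *s u, c *s v) = c * K (u, v)"
    using assms unfolding complex_differentiable_at_def by blast
  then show ?thesis
    unfolding complex_differentiable_at_def
    by (intro exI[of _ "\<lambda>x. f b * K x + L x * g b"] conjI has_derivative_mult)
       (simp_all add: algebra_simps)
qed

lemma complex_differentiable_at_divide:
  assumes "complex_differentiable_at f b" "complex_differentiable_at g b" "g b \<noteq> 0"
  shows "complex_differentiable_at (\<lambda>x. f x / g x) b"
proof -
  obtain L K where "(f has_derivative L) (at b)" "(g has_derivative K) (at b)"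
    "\<forall>c u v. L (c *s u, c *s v) = c * L (u, v)" "\<forall>c u v. K (c *s u, c *s v) = c * K (u, v)"
    using assms unfolding complex_differentiable_at_def by blast
  then show ?thesis
    unfolding complex_differentiable_at_def using assms(3)
    by (intro exI[of _ "\<lambda>x. (L x * g b - f b * K x) / (g b * g b)"] conjI has_derivative_divide')
       (simp_all add: algebra_simps diff_divide_distrib)
qed

lemma complex_differentiable_at_imp_isCont:
  "complex_differentiable_at f b \<Longrightarrow> isCont f b"
  unfolding complex_differentiable_at_def by (blast intro: has_derivative_continuous)

lemma complex_differentiable_at_transform_within_open:
  assumes "complex_differentiable_at f b" "open S" "b \<in> S" "\<And>x. x \<in> S \<Longrightarrow> f x = g x"
  shows "complex_differentiable_at g b"
  using assms unfolding complex_differentiable_at_def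
  by (meson has_derivative_transform_within_open)

section \<open>Polynomial functions\<close>

lemma polys_sum:
  assumes "finite I" "\<And>i. i \<in> I \<Longrightarrow> f i \<in> polys G"
  shows "(\<lambda>x. \<Sum>i\<in>I. f i x) \<in> polys G"
  using assms by (induction I rule: finite_induct) (auto intro: polys.intros)

lemma polys_prod:
  assumes "finite I" "\<And>i. i \<in> I \<Longrightarrow> f i \<in> polys G"
  shows "(\<lambda>x. \<Prod>i\<in>I. f i x) \<in> polys G"
  using assms by (induction I rule: finite_induct) (auto intro: polys.intros)

lemma polys_poly:
  assumes "f \<in> polys G"
  shows "(\<lambda>x. poly L (f x)) \<in> polys G"
  using assms by (induction L) (auto intro: polys.intros)

text \<open>Serves to substitute the i-th pair of coordinates into a polynomial in two
  variables.\<close>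

lemma polys_compose:
  assumes "P \<in> polys G" "\<And>g. g \<in> G \<Longrightarrow> (\<lambda>x. g (h x)) \<in> polys G'"
  shows "(\<lambda>x. P (h x)) \<in> polys G'"
  using assms by (induction P rule: polys.induct) (auto intro: polys.intros)

section \<open>Hermite interpolation\<close>

text \<open>The product of the z - a_i with i \<noteq> j, normalised at a_j, has simple zeros at the
  other nodes, so its square has double zeros there. The derivative at a_j is left
  uncontrolled.\<close>

lemma hermite_bump:
  fixes a :: "'N::finite \<Rightarrow> complex"
  assumes "inj a"
  obtains w where "poly w (a j) = 1"
    "\<And>i. i \<noteq> j \<Longrightarrow> poly w (a i) = 0 \<and> poly (pderiv w) (a i) = 0"
proof -
  define v where "v = (\<Prod>i\<in>UNIV - {j}. [:- a i, 1:])"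
  have vj: "poly v (a j) \<noteq> 0"
    using assms by (auto simp: v_def poly_prod inj_def)
  have vi: "poly v (a i) = 0" if "i \<noteq> j" for i
    unfolding v_def poly_prod using that by (auto intro!: prod_zero bexI[of _ i])
  define u where "u = smult (inverse (poly v (a j))) v"
  show thesis
    by (rule that[of "u * u"]) (use vj vi in \<open>simp_all add: u_def pderiv_mult pderiv_smult field_simps\<close>)
qed

lemma hermite_interpolation:
  fixes a :: "'N::finite \<Rightarrow> complex"
  assumes "inj a"
  obtains L M :: "'N \<Rightarrow> complex poly" where
    "\<And>i j. poly (pderiv (L j)) (a i) = (if i = j then 1 else 0)"
    "\<And>i j. poly (M j) (a i) = (if i = j then 1 else 0)"
    "\<And>i j. poly (pderiv (M j)) (a i) = 0"
proof -
  have "\<exists>w. poly w (a j) = 1 \<and>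
      (\<forall>i. i \<noteq> j \<longrightarrow> poly w (a i) = 0 \<and> poly (pderiv w) (a i) = 0)" for j
    using hermite_bump[OF assms, of j] by blast
  then obtain w where w: "\<And>j. poly (w j) (a j) = 1"
    "\<And>i j. i \<noteq> j \<Longrightarrow> poly (w j) (a i) = 0 \<and> poly (pderiv (w j)) (a i) = 0"
    by metis
  show thesis
  \<comment> \<open>The factor z - a_j turns the value 1 of \<open>w j\<close> at a_j into a
    derivative. In the second family, the linear factor equals 1 at a_j and has derivative -
    (w_j)'(a_j), which cancels the derivative of \<open>w j\<close>. The double zeros at the other
    nodes survive both products.\<close>
  proof (rule that[of "\<lambda>j. w j * [:- a j, 1:]"
        "\<lambda>j. w j * (1 - smult (poly (pderiv (w j)) (a j)) [:- a j, 1:])"], goal_cases)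
    case (1 i j)
    show ?case using w by (cases "i = j") (simp_all add: pderiv_mult pderiv_diff pderiv_smult pderiv_pCons)
  next
    case (2 i j)
    show ?case using w by (cases "i = j") simp_all
  next
    case (3 i j)
    show ?case using w
      by (cases "i = j") (simp_all add: pderiv_mult pderiv_diff pderiv_smult pderiv_pCons)
  qed
qed

section \<open>Local inversion of the invariants\<close>

lemma has_derivative_vec_lambda:
  fixes f :: "'N::finite \<Rightarrow> 'a::real_normed_vector \<Rightarrow> 'b::euclidean_space"
  assumes "\<And>j. (f j has_derivative D j) (at x within S)"
  shows "((\<lambda>x. \<chi> j. f j x) has_derivative (\<lambda>h. \<chi> j. D j h)) (at x within S)"
  by (subst has_derivative_componentwise_within)
     (auto simp: Basis_vec_def inner_axis intro!: has_derivative_inner_left assms)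

lemma has_derivative_poly_compose:
  fixes f :: "'a::real_normed_vector \<Rightarrow> complex"
  assumes "(f has_derivative D) (at x)"
  shows "((\<lambda>x. poly p (f x)) has_derivative (\<lambda>h. poly (pderiv p) (f x) * D h)) (at x)"
  using has_derivative_compose[OF assms, of "poly p" "(*) (poly (pderiv p) (f x))"] poly_DERIV[of p "f x"]
  by (simp add: has_field_derivative_def)

text \<open>The map \<open>f\<close> below consists of functions that are invariant under simultaneous permutations
  of the pairs \<open>(q\<^sub>j, p\<^sub>j)\<close>. Hermite interpolation makes its derivative at \<open>(a, b)\<close> the identity.\<close>

lemma symmetric_local_inverse:
  fixes a b :: "complex ^ 'N::finite"
  assumes "inj (\<lambda>j. a $ j)"
  obtains L M :: "'N \<Rightarrow> complex poly" and f S V g where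
    "\<And>x. f x = (\<chi> j. \<Sum>i\<in>UNIV. poly (L j) (fst x $ i),
                \<chi> j. \<Sum>i\<in>UNIV. snd x $ i * poly (M j) (fst x $ i))"
    "open S" "(a, b) \<in> S" "open V" "\<And>x. x \<in> S \<Longrightarrow> f x \<in> V \<and> g (f x) = x"
    "\<And>y j. y \<in> V \<Longrightarrow> complex_differentiable_at (\<lambda>y. fst (g y) $ j) y"
    "\<And>y j. y \<in> V \<Longrightarrow> complex_differentiable_at (\<lambda>y. snd (g y) $ j) y"
proof -
  obtain L M :: "'N \<Rightarrow> complex poly" where
    L: "\<And>i j. poly (pderiv (L j)) (a $ i) = (if i = j then 1 else 0)" and
    M: "\<And>i j. poly (M j) (a $ i) = (if i = j then 1 else 0)"
       "\<And>i j. poly (pderiv (M j)) (a $ i) = 0"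
    using hermite_interpolation[OF assms] by metis
  define f :: "(complex ^ 'N) \<times> (complex ^ 'N) \<Rightarrow> (complex ^ 'N) \<times> (complex ^ 'N)" where
    "f x = (\<chi> j. \<Sum>i\<in>UNIV. poly (L j) (fst x $ i),
            \<chi> j. \<Sum>i\<in>UNIV. snd x $ i * poly (M j) (fst x $ i))" for x
  define D :: "(complex ^ 'N) \<times> (complex ^ 'N) \<Rightarrow> (complex ^ 'N) \<times> (complex ^ 'N) \<Rightarrow> _" where
    "D x h = (\<chi> j. \<Sum>i\<in>UNIV. poly (pderiv (L j)) (fst x $ i) * fst h $ i,
              \<chi> j. \<Sum>i\<in>UNIV. snd x $ i * (poly (pderiv (M j)) (fst x $ i) * fst h $ i)
                             + snd h $ i * poly (M j) (fst x $ i))" for x h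
  have fst: "((\<lambda>x. fst x $ i) has_derivative (\<lambda>x. fst x $ i)) (at x)"
    for i and x :: "(complex ^ 'N) \<times> (complex ^ 'N)"
    by (intro bounded_linear_imp_has_derivative bounded_linear_compose[OF bounded_linear_vec_nth]
        bounded_linear_fst)
  have snd: "((\<lambda>x. snd x $ i) has_derivative (\<lambda>x. snd x $ i)) (at x)"
    for i and x :: "(complex ^ 'N) \<times> (complex ^ 'N)"
    by (intro bounded_linear_imp_has_derivative bounded_linear_compose[OF bounded_linear_vec_nth]
        bounded_linear_snd)
  have deriv: "(f has_derivative D x) (at x)" for x
    unfolding f_def D_def
    by (intro has_derivative_Pair has_derivative_vec_lambda has_derivative_sum has_derivative_mult
        has_derivative_poly_compose fst snd)
  then have blin: "blinfun_apply (Blinfun (D x)) = D x" for x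
    by (intro bounded_linear_Blinfun_apply has_derivative_bounded_linear)
  \<comment> \<open>The inverse function theorem requires the derivative to be continuous as an
    operator-valued map; in finite dimension this can be tested on basis vectors.\<close>
  have cont: "continuous_on UNIV (\<lambda>x. Blinfun (D x))"
    by (rule continuous_on_blinfun_componentwise, unfold blin D_def) (intro continuous_intros)
  \<comment> \<open>The condition M_j'(a_i) = 0 removes the contribution of \<open>fst h\<close> to
    the second component; the remaining sums are Kronecker deltas.\<close>
  have D0: "D (a, b) = id"
  proof
    fix h
    have "D (a, b) h = (\<chi> j. fst h $ j, \<chi> j. snd h $ j)"
      unfolding D_def by (simp add: L M if_distrib if_distribR cong: if_cong)
    then show "D (a, b) h = id h" by simp
  qed
  have hom: "D x (c *s fst h, c *s snd h) = (c *s fst (D x h), c *s snd (D x h))" for x c h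
    unfolding D_def by (simp add: vec_eq_iff sum_distrib_left algebra_simps)
  have "id_blinfun o\<^sub>L Blinfun (D (a, b)) = id_blinfun"
    using blin[of "(a, b)"] by (intro blinfun_eqI) (simp add: D0)
  from inverse_function_theorem[OF open_UNIV _ cont UNIV_I this, of f] deriv
  obtain S V g g' where S: "open S" "(a, b) \<in> S" and V: "open V" and hm: "homeomorphism S V f g"
    and g': "\<And>y. y \<in> V \<Longrightarrow> (g has_derivative g' y) (at y)"
    "\<And>y. y \<in> V \<Longrightarrow> g' y = inv (D (g y))" "\<And>y. y \<in> V \<Longrightarrow> bij (D (g y))"
    unfolding blin by metis
  \<comment> \<open>The theorem makes \<open>g' y\<close> real linear only. As the inverse of
    \<open>D (g y)\<close>, which is homogeneous by \<open>hom\<close>, it inherits complex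
    homogeneity.\<close>
  have g'_hom: "g' y (c *s u, c *s v) = (c *s fst (g' y (u, v)), c *s snd (g' y (u, v)))"
    if "y \<in> V" for y c u v
  proof -
    have "D (g y) (c *s fst (g' y (u, v)), c *s snd (g' y (u, v))) = (c *s u, c *s v)"
      unfolding hom using g'[OF that] by (simp add: bij_is_surj surj_f_inv_f)
    then show ?thesis
      using g'[OF that] by (metis bij_inv_eq_iff)
  qed
  show thesis
  proof (rule that[OF f_def S V])
    show "f x \<in> V \<and> g (f x) = x" if "x \<in> S" for x
      using hm that by (auto simp: homeomorphism_def)
    show "complex_differentiable_at (\<lambda>y. fst (g y) $ j) y" if "y \<in> V" for y j
      unfolding complex_differentiable_at_def
      by (intro exI[of _ "\<lambda>h. fst (g' y h) $ j"] conjI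
          has_derivative_compose[OF g'(1)[OF that] fst]) (simp add: g'_hom that)
    show "complex_differentiable_at (\<lambda>y. snd (g y) $ j) y" if "y \<in> V" for y j
      unfolding complex_differentiable_at_def
      by (intro exI[of _ "\<lambda>h. snd (g' y h) $ j"] conjI
          has_derivative_compose[OF g'(1)[OF that] snd]) (simp add: g'_hom that)
  qed
qed

text \<open>Passes from total complex differentiability to the form of Osgood's lemma;
  \<open>e\<close> and \<open>e'\<close> tell which numbered variables hold the components of the
  two vectors. Varying the variable i alone moves the argument of \<open>G\<close> along a complex
  line with direction (u, v), and by homogeneity the derivative along it is multiplication by
  \<open>D (u, v)\<close>.\<close>

lemma holomorphic_several_of_complex_differentiable:
  fixes G :: "(complex ^ 'N::finite) \<times> (complex ^ 'N) \<Rightarrow> complex" and e e' :: "'N \<Rightarrow> nat"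
  assumes "open V" "\<And>y. y \<in> V \<Longrightarrow> complex_differentiable_at G y"
  shows "holomorphic_several k {x. (\<chi> j. x (e j), \<chi> j. x (e' j)) \<in> V}
    (\<lambda>x. G (\<chi> j. x (e j), \<chi> j. x (e' j)))"
proof -
  define dec :: "(nat \<Rightarrow> complex) \<Rightarrow> (complex ^ 'N) \<times> (complex ^ 'N)" where
    "dec x = (\<chi> j. x (e j), \<chi> j. x (e' j))" for x
  have cont: "continuous_on UNIV dec"
    unfolding dec_def by (intro continuous_intros continuous_on_product_coordinates)
  have "open (dec -` V)"
    using cont \<open>open V\<close> by (simp add: open_vimage)
  moreover have "continuous_on (dec -` V) (\<lambda>x. G (dec x))"
  proof (rule continuous_on_compose2[of V G])
    show "continuous_on V G"
      using assms(2) complex_differentiable_at_imp_isCont continuous_at_imp_continuous_on by blast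
  qed (auto intro: continuous_on_subset[OF cont])
  moreover have "(\<lambda>z. G (dec (x(i := z)))) field_differentiable at (x i)"
    if "dec x \<in> V" for x i
  proof -
    obtain D where D: "(G has_derivative D) (at (dec x))"
      "\<And>c u v. D (c *s u, c *s v) = c * D (u, v)"
      using assms(2) \<open>dec x \<in> V\<close> unfolding complex_differentiable_at_def by blast
    define u :: "complex ^ 'N" where "u = (\<chi> j. if e j = i then 1 else 0)"
    define v :: "complex ^ 'N" where "v = (\<chi> j. if e' j = i then 1 else 0)"
    have eq: "dec (x(i := z)) = dec x + ((z - x i) *s u, (z - x i) *s v)" for z
      by (auto simp: dec_def u_def v_def vec_eq_iff)
    have "((\<lambda>z. dec x + ((z - x i) *s u, (z - x i) *s v)) has_derivative (\<lambda>z. (z *s u, z *s v)))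
        (at (x i))"
      unfolding vector_scalar_mult_def
      by (auto intro!: derivative_eq_intros has_derivative_vec_lambda)
    then have "((\<lambda>z. G (dec (x(i := z)))) has_derivative (\<lambda>z. D (z *s u, z *s v))) (at (x i))"
      unfolding eq by (rule has_derivative_compose) (simp add: D flip: zero_prod_def)
    then show ?thesis
      unfolding D(2) mult.commute[of _ "D (u, v)"] field_differentiable_def has_field_derivative_def
      by (rule exI)
  qed
  ultimately show ?thesis
    by (simp add: holomorphic_several_def dec_def vimage_def)
qed

section \<open>Separation of orbits by invariants\<close>

lemma separation:
  fixes a :: "'i::finite \<Rightarrow> 'a::metric_space"
  assumes "inj a"
  obtains r where "r > 0" "\<And>i j. dist (a i) (a j) < r \<Longrightarrow> i = j"
proof -
  \<comment> \<open>The extra element 1 keeps \<open>R\<close> nonempty when there is only one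
    index.\<close>
  define R where "R = insert 1 ((\<lambda>(i, j). dist (a i) (a j)) ` {(i, j). i \<noteq> j})"
  have R: "finite R" "R \<noteq> {}" by (auto simp: R_def)
  show thesis
  proof (rule that[of "Min R"])
    show "Min R > 0"
      unfolding Min_gr_iff[OF R] using assms by (auto simp: R_def inj_def)
    show "i = j" if "dist (a i) (a j) < Min R" for i j
      using that unfolding Min_gr_iff[OF R] by (force simp: R_def)
  qed
qed

lemma exists_small_factor:
  fixes f :: "'i::finite \<Rightarrow> complex"
  assumes "norm (\<Prod>i\<in>UNIV. f i) < \<eta> ^ CARD('i)" "\<eta> > 0"
  shows "\<exists>i. norm (f i) < \<eta>"
proof (rule ccontr)
  assume "\<not> ?thesis"
  then have "(\<Prod>i\<in>(UNIV :: 'i set). \<eta>) \<le> (\<Prod>i\<in>UNIV. norm (f i))"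
    using \<open>\<eta> > 0\<close> by (intro prod_mono) (auto simp: not_less)
  then show False using assms by (simp add: prod_norm)
qed

lemma dist_vec_le_sum:
  fixes x y :: "'a::metric_space ^ 'n::finite"
  shows "dist x y \<le> (\<Sum>i\<in>UNIV. dist (x $ i) (y $ i))"
  unfolding dist_vec_def by (rule L2_set_le_sum) simp

text \<open>If the product over \<open>i\<close> of \<open>(q\<^sub>i - a\<^sub>j) + s (p\<^sub>i - b\<^sub>j)\<close> is small, then so is some factor. By the
  pigeonhole principle, among the \<open>N + 1\<close> values of \<open>s\<close> two have the same small factor, and then both
  \<open>q\<^sub>i - a\<^sub>j\<close> and \<open>p\<^sub>i - b\<^sub>j\<close> are small.\<close>

lemma close_up_to_permutation:
  fixes a b :: "complex ^ 'N::finite"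
  assumes "inj (\<lambda>j. a $ j)" "\<epsilon> > 0"
  shows "\<exists>\<delta>>0. \<forall>x :: (complex ^ 'N) \<times> (complex ^ 'N).
    (\<forall>j. \<forall>s\<le>CARD('N).
      norm (\<Prod>i\<in>UNIV. (fst x $ i - a $ j) + of_nat s * (snd x $ i - b $ j)) < \<delta>) \<longrightarrow>
    (\<exists>\<sigma>. bij \<sigma> \<and> dist (permute \<sigma> (fst x), permute \<sigma> (snd x)) (a, b) < \<epsilon>)"
proof -
  define N where "N = CARD('N)"
  obtain r where r: "r > 0" "\<And>i j. dist (a $ i) (a $ j) < r \<Longrightarrow> i = j"
    using separation[OF assms(1)] by metis
  \<comment> \<open>The bound r / 2 makes the matching of indices injective, since two nodes matched
    to the same pair would be closer than 2 \<kappa> \<le> r. The other bound gives 2 N \<kappa> <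
    \<epsilon> for the total distance. The choice of \<eta> absorbs the estimate norm u < \<eta> + N
    (2 \<eta>) below.\<close>
  define \<kappa> where "\<kappa> = min (r / 2) (\<epsilon> / (2 * real N + 1))"
  define \<eta> where "\<eta> = \<kappa> / (1 + 2 * real N)"
  have "\<kappa> > 0" using r(1) assms(2) by (simp add: \<kappa>_def)
  moreover have "\<kappa> \<le> r / 2" "\<kappa> \<le> \<epsilon> / (2 * real N + 1)"
    unfolding \<kappa>_def by (rule min.cobounded1, rule min.cobounded2)
  ultimately have \<kappa>: "\<kappa> > 0" "\<kappa> \<le> r / 2" "(2 * real N + 1) * \<kappa> \<le> \<epsilon>"
    by (simp_all add: pos_le_divide_eq algebra_simps)
  have "1 + 2 * real N > 0" by simp
  then have "\<eta> > 0" "\<eta> * (1 + 2 * real N) = \<kappa>"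
    using \<kappa> by (simp_all add: \<eta>_def)
  then have \<eta>: "\<eta> > 0" "\<eta> + real N * (2 * \<eta>) = \<kappa>"
    by (simp_all add: algebra_simps)
  show ?thesis
  proof (intro exI[of _ "\<eta> ^ N"] conjI allI impI)
    show "\<eta> ^ N > 0" using \<eta> by simp
  next
    fix x :: "(complex ^ 'N) \<times> (complex ^ 'N)"
    assume small: "\<forall>j. \<forall>s\<le>CARD('N).
      norm (\<Prod>i\<in>UNIV. (fst x $ i - a $ j) + of_nat s * (snd x $ i - b $ j)) < \<eta> ^ N"
    have "\<exists>i. norm (fst x $ i - a $ j) < \<kappa> \<and> norm (snd x $ i - b $ j) < \<kappa>" for j
    proof -
      have "\<exists>i. norm ((fst x $ i - a $ j) + of_nat s * (snd x $ i - b $ j)) < \<eta>" if "s \<le> N" for s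
        using small that \<eta>(1) unfolding N_def by (intro exists_small_factor) auto
      then obtain m where
        m: "\<And>s. s \<le> N \<Longrightarrow> norm ((fst x $ m s - a $ j) + of_nat s * (snd x $ m s - b $ j)) < \<eta>"
        by metis
      have "\<not> inj_on m {..N}"
      proof
        assume "inj_on m {..N}"
        then have "card {..N} \<le> CARD('N)" by (intro card_inj_on_le[of m]) auto
        then show False by (simp add: N_def)
      qed
      then obtain s s' where s: "s \<le> N" "s' \<le> N" "s < s'" "m s = m s'"
        unfolding inj_on_def by (metis atMost_iff linorder_neqE_nat)
      define u v where "u = fst x $ m s - a $ j" and "v = snd x $ m s - b $ j"
      have 1: "norm (u + of_nat s * v) < \<eta>" "norm (u + of_nat s' * v) < \<eta>"
        using m[of s] m[of s'] s by (auto simp: u_def v_def)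
      \<comment> \<open>The two small values differ by (s' - s) v with s' - s \<ge> 1, which bounds
        v; then u is a small value minus s v.\<close>
      have "norm v \<le> real (s' - s) * norm v"
        using s by (simp add: mult_le_cancel_right1)
      also have "\<dots> = norm ((u + of_nat s' * v) - (u + of_nat s * v))"
        using s by (simp add: of_nat_diff norm_mult flip: left_diff_distrib)
           (metis norm_of_nat of_nat_diff less_imp_le)
      also have "\<dots> < 2 * \<eta>"
        using norm_triangle_ineq4[of "u + of_nat s' * v" "u + of_nat s * v"] 1 by linarith
      finally have v: "norm v < 2 * \<eta>" .
      have "norm u \<le> norm (u + of_nat s * v) + norm (of_nat s * v)"
        using norm_triangle_ineq4[of "u + of_nat s * v" "of_nat s * v"] by simp
      also have "norm (of_nat s * v) \<le> real N * (2 * \<eta>)"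
        unfolding norm_mult norm_of_nat using v s by (intro mult_mono) auto
      finally have "norm u < \<kappa>" using 1 \<eta> by linarith
      moreover have "norm v < \<kappa>"
      proof -
        have "N \<ge> 1" by (simp add: N_def Suc_leI)
        then have "2 * \<eta> \<le> real N * (2 * \<eta>)" using \<eta> by (simp add: mult_le_cancel_right1)
        then show ?thesis using v \<eta> by linarith
      qed
      ultimately show ?thesis unfolding u_def v_def by blast
    qed
    then obtain \<sigma> where \<sigma>: "\<And>j. norm (fst x $ \<sigma> j - a $ j) < \<kappa>" "\<And>j. norm (snd x $ \<sigma> j - b $ j) < \<kappa>"
      by metis
    have "inj \<sigma>"
    proof (rule injI)
      fix i j assume "\<sigma> i = \<sigma> j"
      then have "dist (a $ i) (a $ j) < \<kappa> + \<kappa>"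
        using \<sigma>(1)[of i] \<sigma>(1)[of j]
        by (intro dist_triangle_lt[of _ "fst x $ \<sigma> i"]) (simp add: dist_norm norm_minus_commute)
      then show "i = j" using r(2) \<kappa> by fastforce
    qed
    moreover have "dist (permute \<sigma> (fst x), permute \<sigma> (snd x)) (a, b) < \<epsilon>"
    proof -
      have *: "dist (permute \<sigma> y) c \<le> real N * \<kappa>" if "\<And>j. norm (y $ \<sigma> j - c $ j) < \<kappa>" for y c
      proof -
        have "dist (permute \<sigma> y) c \<le> (\<Sum>j\<in>(UNIV :: 'N set). \<kappa>)"
          using that by (intro order_trans[OF dist_vec_le_sum] sum_mono)
             (simp add: permute_def dist_norm less_imp_le)
        then show ?thesis by (simp add: N_def)
      qed
      have "dist (permute \<sigma> (fst x), permute \<sigma> (snd x)) (a, b)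
          \<le> dist (permute \<sigma> (fst x)) a + dist (permute \<sigma> (snd x)) b"
        unfolding dist_Pair_Pair by (rule sqrt_sum_squares_le_sum) auto
      also have "\<dots> \<le> real N * \<kappa> + real N * \<kappa>"
        by (intro add_mono * \<sigma>)
      also have "\<dots> < \<epsilon>" using \<kappa> by (simp add: algebra_simps)
      finally show ?thesis .
    qed
    ultimately show "\<exists>\<sigma>. bij \<sigma> \<and> dist (permute \<sigma> (fst x), permute \<sigma> (snd x)) (a, b) < \<epsilon>"
      by (meson bij_def finite finite_UNIV_inj_surj)
  qed
qed

section \<open>Quotients by the symmetric group\<close>

text \<open>Collects what the analysis uses of a quotient by the symmetric group. Points upstairs
  are plain pairs of vectors, so Euclidean calculus applies. Regular functions pull back to
  differentiable ones, and conversely symmetric sums and products of one polynomial in each pair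
  descend to global regular functions.\<close>

locale symmetric_quotient =
  fixes X :: "'a fspace" and Y :: "((complex ^ 'N::finite) \<times> (complex ^ 'N)) set"
    and \<theta> :: "(complex ^ 'N) \<times> (complex ^ 'N) \<Rightarrow> 'a"
  assumes open_Y: "open Y"
    and distinct: "b \<in> Y \<Longrightarrow> inj (\<lambda>j. fst b $ j)"
    and permute_Y: "b \<in> Y \<Longrightarrow> bij \<sigma> \<Longrightarrow> (permute \<sigma> (fst b), permute \<sigma> (snd b)) \<in> Y"
    and image_theta: "\<theta> ` Y = points X"
    and theta_eq_iff: "b \<in> Y \<Longrightarrow> b' \<in> Y \<Longrightarrow>
      \<theta> b = \<theta> b' \<longleftrightarrow> (\<exists>\<sigma>. bij \<sigma> \<and> b' = (permute \<sigma> (fst b), permute \<sigma> (snd b)))"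
    and open_preimage: "openin (ztop X) W \<Longrightarrow> open {b \<in> Y. \<theta> b \<in> W}"
    and regular_differentiable: "openin (ztop X) W \<Longrightarrow> f \<in> regs X W \<Longrightarrow> b \<in> Y \<Longrightarrow> \<theta> b \<in> W \<Longrightarrow>
      complex_differentiable_at (\<lambda>b. f (\<theta> b)) b"
    and symmetric_sum: "P \<in> polys {fst, snd} \<Longrightarrow>
      \<exists>f\<in>regs X (points X). \<forall>b\<in>Y. f (\<theta> b) = (\<Sum>i\<in>UNIV. P (fst b $ i, snd b $ i))"
    and symmetric_prod: "P \<in> polys {fst, snd} \<Longrightarrow>
      \<exists>f\<in>regs X (points X). \<forall>b\<in>Y. f (\<theta> b) = (\<Prod>i\<in>UNIV. P (fst b $ i, snd b $ i))"
begin

lemma openin_analytic_top_subset: "openin (analytic_top X) W \<Longrightarrow> W \<subseteq> points X"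
  by (drule openin_subset) (force simp: analytic_top_def dest: openin_subset)

text \<open>Only the generating sets need an argument, and for them it is the continuity of the
  pullback of a regular function.\<close>

lemma open_analytic_preimage:
  assumes "openin (analytic_top X) W"
  shows "open {b \<in> Y. \<theta> b \<in> W}"
proof -
  have "generate_topology_on
      {{x \<in> U. f x \<in> B} | U f B. openin (ztop X) U \<and> f \<in> regs X U \<and> open B} W"
    using assms unfolding analytic_top_def by (rule openin_topology_generated_by)
  then show ?thesis
  proof induction
    case Empty
    then show ?case by simp
  next
    case (Int A B)
    have "{b \<in> Y. \<theta> b \<in> A \<inter> B} = {b \<in> Y. \<theta> b \<in> A} \<inter> {b \<in> Y. \<theta> b \<in> B}" by blast
    then show ?case using Int by (simp add: open_Int)
  next
    case (UN K)
    have "{b \<in> Y. \<theta> b \<in> \<Union>K} = (\<Union>A\<in>K. {b \<in> Y. \<theta> b \<in> A})" by blast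
    then show ?case using UN by auto
  next
    case (Basis s)
    then obtain U f B where s: "s = {x \<in> U. f x \<in> B}" and
      U: "openin (ztop X) U" "f \<in> regs X U" and "open B"
      by blast
    have "continuous_on {b \<in> Y. \<theta> b \<in> U} (\<lambda>b. f (\<theta> b))"
      using regular_differentiable[OF U] complex_differentiable_at_imp_isCont
      by (intro continuous_at_imp_continuous_on) blast
    then have "open ((\<lambda>b. f (\<theta> b)) -` B \<inter> {b \<in> Y. \<theta> b \<in> U})"
      using continuous_on_open_vimage[OF open_preimage[OF U(1)]] \<open>open B\<close> by blast
    then show ?case
      by (rule back_subst[of "open"]) (auto simp: s)
  qed
qed

lemma open_analytic_image:
  assumes "open S" "S \<subseteq> Y"
  shows "openin (analytic_top X) (\<theta> ` S)"
proof (subst openin_subopen, rule ballI)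
  fix x assume "x \<in> \<theta> ` S"
  then obtain a b where ab: "(a, b) \<in> S" "x = \<theta> (a, b)" by auto
  then obtain \<epsilon> where \<epsilon>: "\<epsilon> > 0" "\<And>y. dist y (a, b) < \<epsilon> \<Longrightarrow> y \<in> S"
    using \<open>open S\<close> unfolding open_dist by blast
  have inj: "inj (\<lambda>j. a $ j)"
    using distinct[of "(a, b)"] ab assms(2) by auto
  obtain \<delta> where \<delta>: "\<delta> > 0" "\<forall>x :: (complex ^ 'N) \<times> (complex ^ 'N).
    (\<forall>j. \<forall>s\<le>CARD('N).
      norm (\<Prod>i\<in>UNIV. (fst x $ i - a $ j) + of_nat s * (snd x $ i - b $ j)) < \<delta>) \<longrightarrow>
    (\<exists>\<sigma>. bij \<sigma> \<and> dist (permute \<sigma> (fst x), permute \<sigma> (snd x)) (a, b) < \<epsilon>)"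
    using close_up_to_permutation[OF inj \<epsilon>(1)] by blast
  have "(\<lambda>x. (fst x + (- a $ j)) + of_nat s * (snd x + (- b $ j))) \<in> polys {fst, snd}" for j s
    by (intro polys.intros) auto
  from symmetric_prod[OF this] have "\<exists>h. h \<in> regs X (points X) \<and> (\<forall>y\<in>Y. h (\<theta> y) =
      (\<Prod>i\<in>UNIV. (fst y $ i - a $ j) + of_nat s * (snd y $ i - b $ j)))" for j s
    by (simp add: Bex_def)
  then obtain f where f: "f j s \<in> regs X (points X) \<and> (\<forall>y\<in>Y. f j s (\<theta> y) =
      (\<Prod>i\<in>UNIV. (fst y $ i - a $ j) + of_nat s * (snd y $ i - b $ j)))" for j s
    by atomize_elim (intro choice allI)
  \<comment> \<open>The functions \<open>f j s\<close> vanish at x, because the factor with i = j is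
    zero, so \<open>T\<close> is a neighbourhood of x. A point of \<open>T\<close> may be
    represented by any y in \<open>Y\<close>; some permutation brings y into the ball inside
    \<open>S\<close> without changing its image under \<open>\<theta>\<close>.\<close>
  define T where
    "T = (\<Inter>j\<in>(UNIV :: 'N set). \<Inter>s\<in>{..CARD('N)}. {x \<in> points X. f j s x \<in> ball 0 \<delta>})"
  have "openin (analytic_top X) {x \<in> points X. f j s x \<in> ball 0 \<delta>}" for j s
    unfolding analytic_top_def by (rule topology_generated_by_Basis) (use f in blast)
  then have "openin (analytic_top X) T"
    unfolding T_def by (intro openin_INT2) auto
  moreover have "x \<in> T"
  proof -
    have "f j s x = 0" for j s
    proof -
      have "f j s x = (\<Prod>i\<in>UNIV. (a $ i - a $ j) + of_nat s * (b $ i - b $ j))"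
        using f[of j s] ab assms(2) by fastforce
      also have "\<dots> = 0" by (rule prod_zero) (auto intro!: exI[of _ j])
      finally show ?thesis .
    qed
    moreover have "x \<in> points X" using ab assms(2) image_theta by blast
    ultimately show ?thesis using \<delta> by (simp add: T_def)
  qed
  moreover have "T \<subseteq> \<theta> ` S"
  proof
    fix z assume z: "z \<in> T"
    then have "z \<in> points X" by (auto simp: T_def)
    then obtain y where y: "y \<in> Y" "z = \<theta> y" using image_theta by blast
    have "norm (\<Prod>i\<in>UNIV. (fst y $ i - a $ j) + of_nat s * (snd y $ i - b $ j)) < \<delta>"
      if "s \<le> CARD('N)" for j s
    proof -
      have "norm (f j s (\<theta> y)) < \<delta>" using z that y(2) by (auto simp: T_def)
      then show ?thesis using f[of j s] y(1) by simp
    qed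
    with \<delta>(2) obtain \<sigma> where
      \<sigma>: "bij \<sigma>" "dist (permute \<sigma> (fst y), permute \<sigma> (snd y)) (a, b) < \<epsilon>"
      by blast
    then have "(permute \<sigma> (fst y), permute \<sigma> (snd y)) \<in> S" using \<epsilon> by blast
    moreover have "\<theta> y = \<theta> (permute \<sigma> (fst y), permute \<sigma> (snd y))"
      using theta_eq_iff[OF y(1) permute_Y[OF y(1) \<sigma>(1)]] \<sigma>(1) by blast
    ultimately show "z \<in> \<theta> ` S" using y by blast
  qed
  ultimately show "\<exists>T. openin (analytic_top X) T \<and> x \<in> T \<and> T \<subseteq> \<theta> ` S" by blast
qed

lemma locally_injective:
  assumes "(a, b) \<in> Y"
  obtains S where "open S" "(a, b) \<in> S" "S \<subseteq> Y" "inj_on \<theta> S"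
proof -
  obtain r where r: "r > 0" "\<And>i j. dist (a $ i) (a $ j) < r \<Longrightarrow> i = j"
    using separation distinct[OF assms] by (metis fst_conv)
  \<comment> \<open>Restricting q suffices: if a permutation relates two points of \<open>S\<close>,
    then a_(\<sigma> j) and a_j are both within r / 2 of the same component, whence \<sigma> j =
    j.\<close>
  define S where "S = Y \<inter> ball a (r / 2) \<times> UNIV"
  show thesis
  proof (rule that[of S])
    show "open S" unfolding S_def by (intro open_Int open_Y open_Times) auto
    show "inj_on \<theta> S"
    proof (rule inj_onI)
      fix x y assume xy: "x \<in> S" "y \<in> S" "\<theta> x = \<theta> y"
      then obtain \<sigma> where \<sigma>: "y = (permute \<sigma> (fst x), permute \<sigma> (snd x))"
        using theta_eq_iff[of x y] by (auto simp: S_def)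
      have near: "dist (a $ j) (fst z $ j) < r / 2" if "z \<in> S" for z j
        using that dist_vec_nth_le[of a j "fst z"] by (auto simp: S_def)
      have "\<sigma> j = j" for j
      proof (rule r(2))
        have "fst y $ j = fst x $ \<sigma> j" by (simp add: \<sigma> permute_def)
        then show "dist (a $ \<sigma> j) (a $ j) < r"
          using near[OF xy(1), of "\<sigma> j"] near[OF xy(2), of j]
          by (metis dist_commute dist_triangle_half_r)
      qed
      then show "x = y" by (simp add: \<sigma> permute_def prod_eq_iff)
    qed
  qed (use assms r in \<open>auto simp: S_def\<close>)
qed

end

section \<open>Construction of charts as local inverses of the quotient map\<close>

context symmetric_quotient
begin

text \<open>A local inverse of \<open>\<theta>\<close> is the local inverse \<open>g\<close> of the
  invariants composed with the invariants themselves, which are global regular functions on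
  \<open>X\<close>. Quantifying over all small \<open>T\<close> leaves room to shrink until
  \<open>\<theta>\<close> is injective.\<close>

lemma locally_holomorphic_lift:
  assumes "(a, b) \<in> Y"
  obtains S where "open S" "(a, b) \<in> S"
    "\<And>T. open T \<Longrightarrow> T \<subseteq> S \<inter> Y \<Longrightarrow> inj_on \<theta> T \<Longrightarrow>
      (\<forall>j. holomorphic_fun X (\<theta> ` T) (\<lambda>x. fst (inv_into T \<theta> x) $ j) \<and>
           holomorphic_fun X (\<theta> ` T) (\<lambda>x. snd (inv_into T \<theta> x) $ j))"
proof -
  have "inj (\<lambda>j. a $ j)" using distinct[OF assms] by simp
  then obtain L M :: "'N \<Rightarrow> complex poly" and f S V g where
    f: "\<And>x. f x = (\<chi> j. \<Sum>i\<in>UNIV. poly (L j) (fst x $ i),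
                \<chi> j. \<Sum>i\<in>UNIV. snd x $ i * poly (M j) (fst x $ i))" and
    S: "open S" "(a, b) \<in> S" and V: "open V" and gf: "\<And>x. x \<in> S \<Longrightarrow> f x \<in> V \<and> g (f x) = x" and
    g: "\<And>y j. y \<in> V \<Longrightarrow> complex_differentiable_at (\<lambda>y. fst (g y) $ j) y"
    "\<And>y j. y \<in> V \<Longrightarrow> complex_differentiable_at (\<lambda>y. snd (g y) $ j) y"
    by (rule symmetric_local_inverse[of a b]) (rule that)
  have "(\<lambda>z. poly (L j) (fst z)) \<in> polys {fst, snd}" for j
    by (intro polys_poly polys.gen) simp
  from symmetric_sum[OF this]
  have "\<exists>h. h \<in> regs X (points X) \<and> (\<forall>y\<in>Y. h (\<theta> y) = fst (f y) $ j)" for j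
    by (simp add: Bex_def f)
  then obtain F where F: "F j \<in> regs X (points X) \<and> (\<forall>y\<in>Y. F j (\<theta> y) = fst (f y) $ j)" for j
    by atomize_elim (intro choice allI)
  have "(\<lambda>z. snd z * poly (M j) (fst z)) \<in> polys {fst, snd}" for j
    by (intro polys.mult polys_poly polys.gen) simp_all
  from symmetric_sum[OF this]
  have "\<exists>h. h \<in> regs X (points X) \<and> (\<forall>y\<in>Y. h (\<theta> y) = snd (f y) $ j)" for j
    by (simp add: Bex_def f)
  then obtain G where G: "G j \<in> regs X (points X) \<and> (\<forall>y\<in>Y. G j (\<theta> y) = snd (f y) $ j)" for j
    by atomize_elim (intro choice allI)
  define N where "N = CARD('N)"
  obtain e :: "'N \<Rightarrow> nat" where e: "bij_betw e UNIV {0..<N}"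
    unfolding N_def using ex_bij_betw_finite_nat[of "UNIV :: 'N set"] by auto
  have inv_e: "inv e (e j) = j" "e j < N" "e j < 2 * N" for j
    using bij_betwE[OF e] bij_betw_imp_inj_on[OF e] by (auto intro: order.strict_trans2[of _ N])
  \<comment> \<open>The 2 N invariants in one numbered list, first those in q alone and then those
    involving p; \<open>dec\<close> unpacks the list into a pair of vectors.\<close>
  define K where "K i = (if i < N then F (inv e i) else G (inv e (i - N)))" for i
  define dec :: "(nat \<Rightarrow> complex) \<Rightarrow> (complex ^ 'N) \<times> (complex ^ 'N)" where
    "dec x = (\<chi> j. x (e j), \<chi> j. x (N + e j))" for x
  have dec: "dec (\<lambda>i. if i < 2 * N then K i (\<theta> y) else 0) = f y" if "y \<in> Y" for y
    using F G that inv_e by (simp add: dec_def K_def prod_eq_iff vec_eq_iff)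
  \<comment> \<open>Stated for a general \<open>H\<close> so that both families of coordinate
    projections are instances.\<close>
  have *: "holomorphic_fun X (\<theta> ` T) (\<lambda>x. H (inv_into T \<theta> x))"
    if T: "open T" "T \<subseteq> S \<inter> Y" "inj_on \<theta> T"
      and H: "\<And>y. y \<in> V \<Longrightarrow> complex_differentiable_at (\<lambda>y. H (g y)) y" for T H
    unfolding holomorphic_fun_def
  proof (rule ballI, intro exI conjI)
    show "openin (ztop X) (points X)" by simp
    show "x \<in> \<theta> ` T" if "x \<in> \<theta> ` T" for x using that .
    show "openin (analytic_top X) (\<theta> ` T)"
      using T by (intro open_analytic_image) auto
    show "\<theta> ` T \<subseteq> \<theta> ` T \<inter> points X" using T image_theta by blast
    show "\<forall>i<2 * N. K i \<in> regs X (points X)" using F G by (simp add: K_def)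
    show "holomorphic_several (2 * N) {x. dec x \<in> V} (\<lambda>x. H (g (dec x)))"
      unfolding dec_def by (rule holomorphic_several_of_complex_differentiable[OF V H])
    show "\<forall>y\<in>\<theta> ` T. (\<lambda>i. if i < 2 * N then K i y else 0) \<in> {x. dec x \<in> V} \<and>
        H (inv_into T \<theta> y) = H (g (dec (\<lambda>i. if i < 2 * N then K i y else 0)))"
    proof
      fix y assume "y \<in> \<theta> ` T"
      then obtain z where z: "z \<in> T" "y = \<theta> z" by blast
      then have zS: "z \<in> S" "z \<in> Y" using T by auto
      then have "dec (\<lambda>i. if i < 2 * N then K i y else 0) = f z"
        unfolding z(2) by (intro dec)
      then show "(\<lambda>i. if i < 2 * N then K i y else 0) \<in> {x. dec x \<in> V} \<and>
        H (inv_into T \<theta> y) = H (g (dec (\<lambda>i. if i < 2 * N then K i y else 0)))"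
        using z T gf[OF zS(1)] by simp
    qed
  qed
  show thesis
  proof (rule that[OF S], intro allI conjI)
    fix T j assume T: "open T" "T \<subseteq> S \<inter> Y" "inj_on \<theta> T"
    show "holomorphic_fun X (\<theta> ` T) (\<lambda>x. fst (inv_into T \<theta> x) $ j)"
      by (rule *[OF T, of "\<lambda>y. fst y $ j"]) (rule g)
    show "holomorphic_fun X (\<theta> ` T) (\<lambda>x. snd (inv_into T \<theta> x) $ j)"
      by (rule *[OF T, of "\<lambda>y. snd y $ j"]) (rule g)
  qed
qed

lemma local_coordinates_exist:
  assumes "x \<in> points X"
  shows "\<exists>U q p. x \<in> U \<and> local_coordinates X U q p \<and> (\<forall>y\<in>U. (q y, p y) \<in> Y \<and> \<theta> (q y, p y) = y)"
proof -
  obtain a b where ab: "(a, b) \<in> Y" "x = \<theta> (a, b)" using assms image_theta by force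
  obtain S1 where S1: "open S1" "(a, b) \<in> S1" "S1 \<subseteq> Y" "inj_on \<theta> S1"
    by (rule locally_injective[OF ab(1)])
  obtain S2 where S2: "open S2" "(a, b) \<in> S2" "\<And>T. open T \<Longrightarrow> T \<subseteq> S2 \<inter> Y \<Longrightarrow> inj_on \<theta> T \<Longrightarrow>
      (\<forall>j. holomorphic_fun X (\<theta> ` T) (\<lambda>x. fst (inv_into T \<theta> x) $ j) \<and>
           holomorphic_fun X (\<theta> ` T) (\<lambda>x. snd (inv_into T \<theta> x) $ j))"
    by (rule locally_holomorphic_lift[OF ab(1)]) (rule that)
  define T where "T = S1 \<inter> S2"
  have T: "open T" "T \<subseteq> Y" "T \<subseteq> S2 \<inter> Y" "inj_on \<theta> T" "(a, b) \<in> T"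
    using S1 S2 by (auto simp: T_def intro: inj_on_subset)
  define \<tau> where "\<tau> = inv_into T \<theta>"
  have \<tau>: "\<And>y. y \<in> T \<Longrightarrow> \<tau> (\<theta> y) = y" "\<And>x. x \<in> \<theta> ` T \<Longrightarrow> \<tau> x \<in> T \<and> \<theta> (\<tau> x) = x"
    using T(4) by (auto simp: \<tau>_def f_inv_into_f inv_into_into)
  have img: "\<tau> ` \<theta> ` T = T" using \<tau>(1) by force
  have openU: "openin (analytic_top X) (\<theta> ` T)" by (rule open_analytic_image[OF T(1,2)])
  have top: "topspace (subtopology (analytic_top X) (\<theta> ` T)) = \<theta> ` T"
    using openin_subset[OF openU] by auto
  have "homeomorphic_maps (subtopology (analytic_top X) (\<theta> ` T)) (top_of_set T) \<tau> \<theta>"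
    unfolding homeomorphic_maps_def
  proof (intro conjI)
    show "continuous_map (subtopology (analytic_top X) (\<theta> ` T)) (top_of_set T) \<tau>"
      unfolding continuous_map_def top
    proof (intro conjI allI impI)
      fix W assume "openin (top_of_set T) W"
      then have "open W" "W \<subseteq> T" using openin_open_eq[OF T(1)] by auto
      then have "openin (analytic_top X) (\<theta> ` W)" using T by (intro open_analytic_image) auto
      moreover have "{x \<in> \<theta> ` T. \<tau> x \<in> W} = \<theta> ` W" using \<open>W \<subseteq> T\<close> \<tau> by force
      ultimately show "openin (subtopology (analytic_top X) (\<theta> ` T)) {x \<in> \<theta> ` T. \<tau> x \<in> W}"
        using openin_open_subtopology[OF openU] \<open>W \<subseteq> T\<close> by auto
    qed (use \<tau> in auto)
    show "continuous_map (top_of_set T) (subtopology (analytic_top X) (\<theta> ` T)) \<theta>"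
      unfolding continuous_map_def top
    proof (intro conjI allI impI)
      fix W assume "openin (subtopology (analytic_top X) (\<theta> ` T)) W"
      then have "open {b \<in> Y. \<theta> b \<in> W}"
        using openin_open_subtopology[OF openU] by (intro open_analytic_preimage) auto
      moreover have "{x \<in> topspace (top_of_set T). \<theta> x \<in> W} = T \<inter> {b \<in> Y. \<theta> b \<in> W}"
        using T by auto
      ultimately show "openin (top_of_set T) {x \<in> topspace (top_of_set T). \<theta> x \<in> W}"
        by (simp add: openin_open_Int)
    qed auto
  qed (use \<tau> top in auto)
  then have homeo: "homeomorphic_map (subtopology (analytic_top X) (\<theta> ` T)) (top_of_set T) \<tau>"
    using homeomorphic_map_maps by blast
  \<comment> \<open>The inverse of the chart is \<open>\<theta>\<close> itself, so a regular
    function \<open>f\<close> reads in the chart as its pullback along \<open>\<theta>\<close>,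
    which is differentiable.\<close>
  have inv: "inv_into (\<theta> ` T) \<tau> y = \<theta> y" if "y \<in> T" for y
  proof (rule inv_into_f_eq)
    show "inj_on \<tau> (\<theta> ` T)" using \<tau>(2) by (metis inj_onI)
  qed (use that \<tau> in auto)
  have diff: "complex_differentiable_at (\<lambda>y. f (inv_into (\<theta> ` T) \<tau> y)) y"
    if "openin (ztop X) V" "f \<in> regs X V" "y \<in> \<tau> ` (\<theta> ` T \<inter> V)" for V f y
  proof -
    have y: "y \<in> T" "\<theta> y \<in> V" using that(3) \<tau> by auto
    show ?thesis
    proof (rule complex_differentiable_at_transform_within_open)
      show "complex_differentiable_at (\<lambda>b. f (\<theta> b)) y"
        using that y T by (intro regular_differentiable) auto
    qed (use T(1) y inv in auto)
  qed
  have "local_coordinates X (\<theta> ` T) (\<lambda>x. fst (\<tau> x)) (\<lambda>x. snd (\<tau> x))"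
    unfolding local_coordinates_def prod.collapse img complex_differentiable_on_iff
    using openU T(1) homeo S2(3)[OF T(1,3,4), folded \<tau>_def] diff by blast
  then show ?thesis
    using T \<tau> ab by (intro exI[of _ "\<theta> ` T"] exI[of _ "\<lambda>x. fst (\<tau> x)"] exI[of _ "\<lambda>x. snd (\<tau> x)"]) auto
qed

section \<open>Uniqueness of charts up to permutation\<close>

lemma local_coordinates_open_vimage:
  assumes "local_coordinates X U q p" "open B"
  shows "openin (analytic_top X) {y \<in> U. q y \<in> B}"
proof -
  have U: "openin (analytic_top X) U" and
    cont: "continuous_map (subtopology (analytic_top X) U) (top_of_set ((\<lambda>x. (q x, p x)) ` U))
      (\<lambda>x. (q x, p x))"
    using assms(1) by (auto simp: local_coordinates_def homeomorphic_imp_continuous_map)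
  have "continuous_map (subtopology (analytic_top X) U) euclidean (\<lambda>x. fst (q x, p x))"
    using continuous_map_compose[OF continuous_map_into_fulltopology[OF cont], of euclidean fst]
    by (simp add: o_def continuous_on_fst)
  then have "openin (subtopology (analytic_top X) U) {y \<in> topspace (analytic_top X) \<inter> U. q y \<in> B}"
    using \<open>open B\<close> by (auto simp: continuous_map_def)
  moreover have "topspace (analytic_top X) \<inter> U = U" using openin_subset[OF U] by blast
  ultimately show ?thesis using openin_open_subtopology[OF U] by auto
qed

lemma local_coordinates_unique:
  assumes coords: "local_coordinates X U q p" "local_coordinates X U' q' p'"
    and lift: "\<And>y. y \<in> U \<Longrightarrow> (q y, p y) \<in> Y \<and> \<theta> (q y, p y) = y"
      "\<And>y. y \<in> U' \<Longrightarrow> (q' y, p' y) \<in> Y \<and> \<theta> (q' y, p' y) = y"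
    and x: "x \<in> U \<inter> U'"
  shows "\<exists>\<sigma> W. bij \<sigma> \<and> openin (analytic_top X) W \<and> x \<in> W \<and> W \<subseteq> U \<inter> U' \<and>
    (\<forall>y\<in>W. q' y = permute \<sigma> (q y) \<and> p' y = permute \<sigma> (p y))"
proof -
  have perm: "\<exists>\<sigma>. bij \<sigma> \<and> q' y = permute \<sigma> (q y) \<and> p' y = permute \<sigma> (p y)" if "y \<in> U \<inter> U'" for y
    using theta_eq_iff[of "(q y, p y)" "(q' y, p' y)"] lift that by auto
  obtain \<sigma> where \<sigma>: "bij \<sigma>" "q' x = permute \<sigma> (q x)" using perm[OF x] by blast
  have "inj (\<lambda>j. q x $ j)" using distinct lift(1) x by fastforce
  then obtain r where r: "r > 0" "\<And>i j. dist (q x $ i) (q x $ j) < r \<Longrightarrow> i = j"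
    using separation by metis
  define W where "W = {y \<in> U. q y \<in> ball (q x) (r / 2)} \<inter> {y \<in> U'. q' y \<in> ball (q' x) (r / 2)}"
  have "q' y = permute \<sigma> (q y) \<and> p' y = permute \<sigma> (p y)" if y: "y \<in> W" for y
  proof -
    obtain \<sigma>' where \<sigma>': "q' y = permute \<sigma>' (q y)" "p' y = permute \<sigma>' (p y)"
      using perm[of y] y by (auto simp: W_def)
    have "\<sigma> j = \<sigma>' j" for j
    proof (rule r(2))
      \<comment> \<open>The number q_(\<sigma>' j)(y) = q'_j(y) is close to q_(\<sigma>' j)(x) by
        continuity of q, and to q'_j(x) = q_(\<sigma> j)(x) by continuity of q'. Separation of the
        components of \<open>q x\<close> identifies the two indices. As \<sigma>' permutes both
        vectors, this settles p as well.\<close>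
      have 1: "dist (q x $ \<sigma>' j) (q y $ \<sigma>' j) < r / 2"
        using y dist_vec_nth_le[of "q x" "\<sigma>' j" "q y"] by (auto simp: W_def)
      have "dist (q' x $ j) (q' y $ j) < r / 2"
        using y dist_vec_nth_le[of "q' x" j "q' y"] by (auto simp: W_def)
      then have "dist (q x $ \<sigma> j) (q y $ \<sigma>' j) < r / 2"
        by (simp add: \<sigma> \<sigma>' permute_def)
      with 1 show "dist (q x $ \<sigma> j) (q x $ \<sigma>' j) < r"
        by (metis dist_commute dist_triangle_half_r)
    qed
    then have "\<sigma> = \<sigma>'" by blast
    then show ?thesis using \<sigma>' by simp
  qed
  moreover have "openin (analytic_top X) W"
    unfolding W_def using coords by (intro openin_Int local_coordinates_open_vimage) auto
  moreover have "x \<in> W" "W \<subseteq> U \<inter> U'" using x r by (auto simp: W_def)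
  ultimately show ?thesis using \<sigma>(1) by blast
qed

end

section \<open>The cotangent bundle in canonical coordinates\<close>

text \<open>The trivialisation of the cotangent bundle by the coframe dq_j, through which all
  statements about covectors become statements about pairs of vectors.\<close>

definition cotangent_point :: "(complex ^ 'N::finite) \<times> (complex ^ 'N) \<Rightarrow> 'N cotangent_point" where
  "cotangent_point b = (fst b, covec (snd b))"

lemma covec_axis [simp]: "covec p (axis j 1) = p $ j"
  by (simp add: covec_def axis_def if_distrib cong: if_cong)

lemma linear_covec: "Vector_Spaces.linear (*s) (*) (covec p)"
  by (auto simp: Vector_Spaces.linear_def module_hom_def module_hom_axioms_def covec_def
      vector_space_def module_def algebra_simps sum.distrib sum_distrib_left)

lemma linear_eq_covec:
  assumes "Vector_Spaces.linear (*s) (*) \<alpha>"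
  shows "\<alpha> = covec (\<chi> j. \<alpha> (axis j 1))"
proof
  fix v
  interpret Vector_Spaces.linear "(*s)" "(*)" \<alpha> by fact
  have "\<alpha> v = \<alpha> (\<Sum>j\<in>UNIV. v $ j *s axis j 1)" by (simp add: basis_expansion)
  also have "\<dots> = (\<Sum>j\<in>UNIV. v $ j * \<alpha> (axis j 1))" by (simp add: sum scale)
  finally show "\<alpha> v = covec (\<chi> j. \<alpha> (axis j 1)) v" by (simp add: covec_def mult.commute)
qed

lemma cotangent_point_eq_iff [simp]: "cotangent_point b = cotangent_point b' \<longleftrightarrow> b = b'"
proof
  assume eq: "cotangent_point b = cotangent_point b'"
  then have "snd b $ j = snd b' $ j" for j
    unfolding cotangent_point_def by (metis covec_axis prod.inject)
  then show "b = b'" using eq by (simp add: cotangent_point_def prod_eq_iff vec_eq_iff)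
qed simp

lemma cotangent_point_in_cotangent [simp]: "cotangent_point b \<in> cotangent B \<longleftrightarrow> fst b \<in> B"
  by (simp add: cotangent_point_def cotangent_def linear_covec)

lemma cotangent_pointE:
  assumes "y \<in> cotangent B"
  obtains b where "y = cotangent_point b"
  using assms linear_eq_covec by (fastforce simp: cotangent_def cotangent_point_def)

lemma permute_cotangent_point:
  "bij \<sigma> \<Longrightarrow> permute_cotangent \<sigma> (cotangent_point b)
    = cotangent_point (permute \<sigma> (fst b), permute \<sigma> (snd b))"
  by (simp add: cotangent_point_def permute_cotangent_covec)

text \<open>Permuting indices is a right action, hence the reversed order.\<close>

lemma permute_permute: "permute \<tau> (permute \<sigma> q) = permute (\<sigma> \<circ> \<tau>) q"
  by (simp add: permute_def)

lemma permute_id [simp]: "permute id q = q"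
  by (simp add: permute_def)

lemma orbit_cotangent_point:
  "orbit (cotangent_point b)
    = {cotangent_point (permute \<sigma> (fst b), permute \<sigma> (snd b)) | \<sigma>. bij \<sigma>}"
  unfolding orbit_def using permute_cotangent_point by metis

lemma cotangent_point_in_orbit: "cotangent_point b \<in> orbit (cotangent_point b)"
  unfolding orbit_cotangent_point by (rule CollectI, rule exI[of _ id]) simp

lemma orbit_eq_iff:
  "orbit (cotangent_point b) = orbit (cotangent_point b') \<longleftrightarrow>
    (\<exists>\<sigma>. bij \<sigma> \<and> b' = (permute \<sigma> (fst b), permute \<sigma> (snd b)))"
proof
  assume "orbit (cotangent_point b) = orbit (cotangent_point b')"
  then have "cotangent_point b' \<in> orbit (cotangent_point b)" using cotangent_point_in_orbit by blast
  then show "\<exists>\<sigma>. bij \<sigma> \<and> b' = (permute \<sigma> (fst b), permute \<sigma> (snd b))"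
    by (auto simp: orbit_cotangent_point)
next
  assume "\<exists>\<sigma>. bij \<sigma> \<and> b' = (permute \<sigma> (fst b), permute \<sigma> (snd b))"
  then obtain \<sigma> where \<sigma>: "bij \<sigma>" "b' = (permute \<sigma> (fst b), permute \<sigma> (snd b))" by blast
  \<comment> \<open>One inclusion, applied to \<sigma> and to its inverse, gives equality.\<close>
  have sub: "orbit (cotangent_point (permute \<sigma> (fst b), permute \<sigma> (snd b))) \<subseteq> orbit (cotangent_point b)"
    if "bij \<sigma>" for \<sigma> and b :: "(complex ^ 'a) \<times> (complex ^ 'a)"
    unfolding orbit_cotangent_point fst_conv snd_conv permute_permute using bij_comp[OF _ that] by blast
  have "\<sigma> \<circ> inv \<sigma> = id" using \<sigma>(1) by (simp add: bij_is_surj surj_iff[symmetric])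
  then have "b = (permute (inv \<sigma>) (fst b'), permute (inv \<sigma>) (snd b'))"
    by (simp add: \<sigma>(2) permute_permute)
  then show "orbit (cotangent_point b) = orbit (cotangent_point b')"
    using sub[OF \<sigma>(1), of b] sub[OF bij_imp_bij_inv[OF \<sigma>(1)], of b'] \<sigma>(2) by auto
qed

section \<open>From the Zariski structure to Euclidean analysis\<close>

lemma polys_cotangent_differentiable:
  assumes "f \<in> polys cotangent_coords"
  shows "complex_differentiable_at (\<lambda>b. f (cotangent_point b)) b"
  using assms
proof induction
  case (gen f)
  then show ?case
    by (auto simp: cotangent_coords_def cotangent_point_def
        intro: complex_differentiable_at_fst complex_differentiable_at_snd)
qed (auto intro: complex_differentiable_at_const complex_differentiable_at_add
    complex_differentiable_at_mult)

lemma points_zariski [simp]: "points (zariski G A) = A"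
proof -
  have "A \<in> {{x \<in> A. f x \<noteq> 0} | f. f \<in> polys G}"
    by (rule CollectI, rule exI[of _ "\<lambda>_. 1"]) (simp add: polys.const)
  then have "\<Union>{{x \<in> A. f x \<noteq> 0} | f. f \<in> polys G} = A"
    by (intro equalityI Union_upper Union_least) auto
  then show ?thesis by (simp add: zariski_def Let_def)
qed

lemma zariski_regularI:
  assumes "supported A h" "g \<in> polys G" "\<And>y. y \<in> A \<Longrightarrow> h y = g y"
  shows "h \<in> regs (zariski G A) A"
proof -
  have "openin (ztop (zariski G A)) A"
    using openin_topspace[of "ztop (zariski G A)"] by simp
  moreover have "\<exists>a\<in>polys G. \<exists>b\<in>polys G. \<forall>y\<in>A. b y \<noteq> 0 \<and> h y = a y / b y"
    using assms polys.const[of 1] by (intro bexI[of _ g] bexI[of _ "\<lambda>_. 1"]) auto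
  ultimately show ?thesis
    using assms(1) unfolding zariski_def Let_def by auto
qed

text \<open>Basic open sets are nonvanishing loci of continuous functions intersected with
  \<open>A\<close>, which is why \<open>A\<close> itself has to be open in the coordinates.\<close>

lemma zariski_open_imp_open:
  assumes "openin (ztop (zariski cotangent_coords A)) W" "open (cotangent_point -` A)"
  shows "open (cotangent_point -` W)"
proof -
  have "generate_topology_on {{x \<in> A. f x \<noteq> 0} | f. f \<in> polys cotangent_coords} W"
    using assms(1) unfolding zariski_def Let_def by (simp add: openin_topology_generated_by_iff)
  then show ?thesis
  proof induction
    case (Basis s)
    then obtain f where s: "s = {x \<in> A. f x \<noteq> 0}" and f: "f \<in> polys cotangent_coords" by blast
    have "continuous_on UNIV (\<lambda>b. f (cotangent_point b))"
      using polys_cotangent_differentiable[OF f] complex_differentiable_at_imp_isCont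
      by (intro continuous_at_imp_continuous_on) blast
    then have "open {b. f (cotangent_point b) \<noteq> 0}"
      by (intro open_Collect_neq) auto
    moreover have "cotangent_point -` s = cotangent_point -` A \<inter> {b. f (cotangent_point b) \<noteq> 0}"
      by (auto simp: s)
    ultimately show ?case using assms(2) by (simp add: open_Int)
  qed (auto simp: vimage_Union open_Int)
qed

lemma zariski_regular_differentiable:
  assumes "h \<in> regs (zariski cotangent_coords A) U" "open (cotangent_point -` A)"
    and "cotangent_point b \<in> U"
  shows "complex_differentiable_at (\<lambda>b. h (cotangent_point b)) b"
proof -
  from assms(1,3) obtain W f g where W: "openin (ztop (zariski cotangent_coords A)) W"
      "cotangent_point b \<in> W" and
    fg: "f \<in> polys cotangent_coords" "g \<in> polys cotangent_coords"
      "\<And>y. y \<in> W \<Longrightarrow> g y \<noteq> 0 \<and> h y = f y / g y"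
    by (simp add: zariski_def Let_def) blast
  show ?thesis
  proof (rule complex_differentiable_at_transform_within_open)
    show "complex_differentiable_at (\<lambda>b. f (cotangent_point b) / g (cotangent_point b)) b"
      using fg W by (intro complex_differentiable_at_divide polys_cotangent_differentiable) auto
    show "open (cotangent_point -` W)" by (rule zariski_open_imp_open[OF W(1) assms(2)])
  qed (use W fg in auto)
qed

lemma points_quotient_space [simp]: "points (quotient_space X \<pi>) = \<pi> ` points X"
proof
  have "openin (ztop (quotient_space X \<pi>)) (points (quotient_space X \<pi>))" by simp
  then show "points (quotient_space X \<pi>) \<subseteq> \<pi> ` points X"
    unfolding openin_quotient_space by blast
  have "{x \<in> points X. \<pi> x \<in> \<pi> ` points X} = points X" by blast
  then have "openin (ztop (quotient_space X \<pi>)) (\<pi> ` points X)"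
    unfolding openin_quotient_space by simp
  then show "\<pi> ` points X \<subseteq> points (quotient_space X \<pi>)" by (rule openin_subset)
qed

text \<open>The map \<open>\<theta>\<close> is the orbit map followed by the inverse of
  \<open>\<Phi>\<close>. Open sets and regular functions of \<open>X\<close> are pulled back in two
  stages, through the quotient and then to the cotangent bundle; invariant polynomials travel the
  opposite way, down to the quotient and then along \<open>\<Phi>\<close>.\<close>

lemma symmetric_quotient_of_isomorphism:
  fixes Y :: "((complex ^ 'N::finite) \<times> (complex ^ 'N)) set"
  assumes iso: "isomorphism X
      (quotient_space (zariski cotangent_coords (cotangent_point ` Y)) orbit) \<Phi>"
    and open_Y: "open Y"
    and distinct: "\<And>b. b \<in> Y \<Longrightarrow> inj (\<lambda>j. fst b $ j)"
    and permute_Y: "\<And>b \<sigma>. b \<in> Y \<Longrightarrow> bij \<sigma> \<Longrightarrow> (permute \<sigma> (fst b), permute \<sigma> (snd b)) \<in> Y"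
  obtains \<theta> where "symmetric_quotient X Y \<theta>"
    "\<And>b. b \<in> Y \<Longrightarrow> \<Phi> (\<theta> b) = orbit (cotangent_point b)"
proof -
  define Z where "Z = zariski cotangent_coords (cotangent_point ` Y)"
  define Q where "Q = quotient_space Z orbit"
  obtain \<psi> where \<Phi>: "morphism X Q \<Phi>" and \<psi>: "morphism Q X \<psi>" and
    inv: "\<And>x. x \<in> points X \<Longrightarrow> \<psi> (\<Phi> x) = x" "\<And>y. y \<in> points Q \<Longrightarrow> \<Phi> (\<psi> y) = y"
    using iso unfolding isomorphism_def Q_def Z_def by blast
  have vimage: "cotangent_point -` cotangent_point ` Y = Y" by auto
  have pZ: "points Z = cotangent_point ` Y" by (simp add: Z_def)
  have pQ: "points Q = orbit ` cotangent_point ` Y" by (simp add: Q_def pZ)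
  have \<Phi>_in: "\<Phi> x \<in> points Q" if "x \<in> points X" for x
    using \<Phi> that continuous_map_image_subset_topspace unfolding morphism_def by blast
  have \<psi>_in: "\<psi> y \<in> points X" if "y \<in> points Q" for y
    using \<psi> that continuous_map_image_subset_topspace unfolding morphism_def by blast
  define \<theta> where "\<theta> b = \<psi> (orbit (cotangent_point b))" for b
  have \<Phi>\<theta>: "\<Phi> (\<theta> b) = orbit (cotangent_point b)" if "b \<in> Y" for b
    using that by (simp add: \<theta>_def inv pQ)
  define W' where "W' W = {y \<in> points Q. \<psi> y \<in> W}" for W
  define W'' where "W'' W = {y \<in> points Z. orbit y \<in> W' W}" for W
  have W'': "cotangent_point -` W'' W = {b \<in> Y. \<theta> b \<in> W}" for W
    by (auto simp: W''_def W'_def pZ pQ \<theta>_def)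
  have open_pre: "open {b \<in> Y. \<theta> b \<in> W}" if "openin (ztop X) W" for W
  proof -
    have "openin (ztop Q) (W' W)"
      using \<psi> that by (simp add: morphism_def continuous_map_def W'_def)
    then have "openin (ztop Z) (W'' W)"
      by (simp add: Q_def openin_quotient_space W''_def)
    then have "open (cotangent_point -` W'' W)"
      unfolding Z_def by (rule zariski_open_imp_open) (simp only: vimage open_Y)
    then show ?thesis by (simp only: W'')
  qed
  have reg: "complex_differentiable_at (\<lambda>b. f (\<theta> b)) b"
    if "openin (ztop X) W" "f \<in> regs X W" "b \<in> Y" "\<theta> b \<in> W" for W f b
  proof -
    have "cut (W' W) (\<lambda>y. f (\<psi> y)) \<in> regs Q (W' W)"
      using \<psi> that by (simp add: morphism_def W'_def)
    then have *: "cut (W'' W) (\<lambda>x. cut (W' W) (\<lambda>y. f (\<psi> y)) (orbit x)) \<in> regs Z (W'' W)"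
      by (simp add: Q_def quotient_space_def W''_def)
    show ?thesis
    \<comment> \<open>The pullback carries a \<open>cut\<close> from each stage; both are invisible
      on the open preimage of \<open>W\<close>.\<close>
    proof (rule complex_differentiable_at_transform_within_open)
      show "complex_differentiable_at
          (\<lambda>b. cut (W'' W) (\<lambda>x. cut (W' W) (\<lambda>y. f (\<psi> y)) (orbit x)) (cotangent_point b)) b"
      proof (rule zariski_regular_differentiable[OF *[unfolded Z_def]])
        show "open (cotangent_point -` cotangent_point ` Y)" by (simp only: vimage open_Y)
        show "cotangent_point b \<in> W'' W" using that W''[of W] by blast
      qed
      show "open {b \<in> Y. \<theta> b \<in> W}" by (rule open_pre) fact
      show "b \<in> {b \<in> Y. \<theta> b \<in> W}" using that by simp
      show "cut (W'' W) (\<lambda>x. cut (W' W) (\<lambda>y. f (\<psi> y)) (orbit x)) (cotangent_point x) = f (\<theta> x)"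
        if "x \<in> {b \<in> Y. \<theta> b \<in> W}" for x
        using that by (auto simp: cut_def W''_def W'_def pZ pQ \<theta>_def)
    qed
  qed
  have invariant: "\<exists>f\<in>regs X (points X). \<forall>b\<in>Y. f (\<theta> b) = G (cotangent_point b)"
    if G: "G \<in> polys cotangent_coords"
      "\<And>b \<sigma>. bij \<sigma> \<Longrightarrow> G (cotangent_point (permute \<sigma> (fst b), permute \<sigma> (snd b))) = G (cotangent_point b)"
    for G
  proof -
    \<comment> \<open>An arbitrary representative of the orbit may be chosen, since \<open>G\<close>
      is constant on orbits. The \<open>cut\<close> enforces the convention that sections vanish
      outside their domain.\<close>
    define h where "h = cut (points Q) (\<lambda>y. G (SOME x. x \<in> y))"
    have h: "h (orbit (cotangent_point b)) = G (cotangent_point b)" if "b \<in> Y" for b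
    proof -
      have "(SOME x. x \<in> orbit (cotangent_point b)) \<in> orbit (cotangent_point b)"
        using cotangent_point_in_orbit by (rule someI)
      then have "G (SOME x. x \<in> orbit (cotangent_point b)) = G (cotangent_point b)"
        unfolding orbit_cotangent_point using G(2) by auto
      then show ?thesis using that by (simp add: h_def cut_def pQ)
    qed
    have "cut (points Z) (\<lambda>x. h (orbit x)) \<in> regs Z (points Z)"
      unfolding pZ unfolding Z_def
      by (rule zariski_regularI[OF _ G(1)]) (auto simp: supported_def cut_def h)
    moreover have "{x \<in> points Z. orbit x \<in> points Q} = points Z" by (auto simp: pZ pQ)
    moreover have "h \<in> regs Q (points Q) \<longleftrightarrow> supported (points Q) h \<and>
        cut {x \<in> points Z. orbit x \<in> points Q} (\<lambda>x. h (orbit x))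
          \<in> regs Z {x \<in> points Z. orbit x \<in> points Q}"
      by (simp add: Q_def quotient_space_def)
    moreover have "supported (points Q) h" by (simp add: h_def supported_def cut_def)
    ultimately have "h \<in> regs Q (points Q)" by simp
    then have "cut {x \<in> points X. \<Phi> x \<in> points Q} (\<lambda>x. h (\<Phi> x)) \<in> regs X {x \<in> points X. \<Phi> x \<in> points Q}"
      using \<Phi> unfolding morphism_def by (meson openin_topspace)
    moreover have "{x \<in> points X. \<Phi> x \<in> points Q} = points X" using \<Phi>_in by blast
    ultimately have "cut (points X) (\<lambda>x. h (\<Phi> x)) \<in> regs X (points X)" by simp
    moreover have "cut (points X) (\<lambda>x. h (\<Phi> x)) (\<theta> b) = G (cotangent_point b)" if "b \<in> Y" for b
    proof -
      have "\<theta> b \<in> points X" using that \<psi>_in by (simp add: \<theta>_def pQ)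
      then show ?thesis using that by (simp add: cut_def \<Phi>\<theta> h)
    qed
    ultimately show ?thesis by blast
  qed
  have poly_i: "(\<lambda>y. P (fst y $ i, snd y (axis i 1))) \<in> polys cotangent_coords"
    if "P \<in> polys {fst, snd}" for P and i :: 'N
    using that by (rule polys_compose) (auto simp: cotangent_coords_def case_prod_unfold intro!: polys.gen)
  have "symmetric_quotient X Y \<theta>"
  proof
    show "\<theta> ` Y = points X"
    proof
      show "\<theta> ` Y \<subseteq> points X" using \<psi>_in by (auto simp: \<theta>_def pQ)
      show "points X \<subseteq> \<theta> ` Y"
      proof
        fix x assume x: "x \<in> points X"
        then obtain b where "b \<in> Y" "\<Phi> x = orbit (cotangent_point b)" using \<Phi>_in unfolding pQ by blast
        then show "x \<in> \<theta> ` Y" using inv(1)[OF x] by (auto simp: \<theta>_def)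
      qed
    qed
    show "\<theta> b = \<theta> b' \<longleftrightarrow> (\<exists>\<sigma>. bij \<sigma> \<and> b' = (permute \<sigma> (fst b), permute \<sigma> (snd b)))"
      if "b \<in> Y" "b' \<in> Y" for b b'
      unfolding orbit_eq_iff[symmetric]
    proof
      assume "\<theta> b = \<theta> b'"
      from arg_cong[OF this, of \<Phi>] show "orbit (cotangent_point b) = orbit (cotangent_point b')"
        using that by (simp only: \<Phi>\<theta>)
    qed (simp only: \<theta>_def)
    show "\<exists>f\<in>regs X (points X). \<forall>b\<in>Y. f (\<theta> b) = (\<Sum>i\<in>UNIV. P (fst b $ i, snd b $ i))"
      if "P \<in> polys {fst, snd}" for P
    proof -
      have "(\<Sum>i\<in>UNIV. P (q $ \<sigma> i, p $ \<sigma> i)) = (\<Sum>i\<in>UNIV. P (q $ i, p $ i))"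
        if "bij \<sigma>" for \<sigma> and q p :: "complex ^ 'N"
        by (rule sum.reindex_bij_betw) fact
      then have "\<exists>f\<in>regs X (points X). \<forall>b\<in>Y. f (\<theta> b) =
          (\<lambda>y. \<Sum>i\<in>UNIV. P (fst y $ i, snd y (axis i 1))) (cotangent_point b)"
        by (intro invariant polys_sum poly_i that) (simp_all add: cotangent_point_def permute_def)
      then show ?thesis by (simp add: cotangent_point_def)
    qed
    show "\<exists>f\<in>regs X (points X). \<forall>b\<in>Y. f (\<theta> b) = (\<Prod>i\<in>UNIV. P (fst b $ i, snd b $ i))"
      if "P \<in> polys {fst, snd}" for P
    proof -
      have "(\<Prod>i\<in>UNIV. P (q $ \<sigma> i, p $ \<sigma> i)) = (\<Prod>i\<in>UNIV. P (q $ i, p $ i))"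
        if "bij \<sigma>" for \<sigma> and q p :: "complex ^ 'N"
        by (rule prod.reindex_bij_betw) fact
      then have "\<exists>f\<in>regs X (points X). \<forall>b\<in>Y. f (\<theta> b) =
          (\<lambda>y. \<Prod>i\<in>UNIV. P (fst y $ i, snd y (axis i 1))) (cotangent_point b)"
        by (intro invariant polys_prod poly_i that) (simp_all add: cotangent_point_def permute_def)
      then show ?thesis by (simp add: cotangent_point_def)
    qed
  qed (rule open_Y distinct permute_Y open_pre reg; assumption)+
  then show thesis using \<Phi>\<theta> by (rule that)
qed

section \<open>The configuration space and the canonical coordinate system\<close>

lemma in_base_minus_Delta_iff:
  "q \<in> base P - Delta P \<longleftrightarrow> q \<in> base P \<and> inj (\<lambda>j. q $ j)"
  by (auto simp: base_def Delta_def inj_def)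

lemma open_base:
  assumes "finite P"
  shows "open (base P :: (complex ^ 'N::finite) set)"
proof -
  have "finite {z. Some z \<in> P}"
    using finite_vimageI[OF assms, of Some] by (simp add: vimage_def)
  then have "open ((\<lambda>q :: complex ^ 'N. q $ j) -` (- {z. Some z \<in> P}))" for j
    by (intro open_vimage continuous_intros) (simp add: finite_imp_closed open_closed)
  then have "open (\<Inter>j. (\<lambda>q :: complex ^ 'N. q $ j) -` (- {z. Some z \<in> P}))" by auto
  then show ?thesis by (rule back_subst[of "open"]) (auto simp: base_def)
qed

lemma open_distinct: "open {q :: complex ^ 'N::finite. inj (\<lambda>j. q $ j)}"
proof -
  have "open (\<Inter>i. \<Inter>j\<in>- {i}. {q :: complex ^ 'N. q $ i \<noteq> q $ j})"
    by (intro open_INT ballI open_Collect_neq continuous_intros) auto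
  then show ?thesis by (rule back_subst[of "open"]) (auto simp: inj_def)
qed

text \<open>In terms of \<open>\<theta>\<close>, a canonical chart is exactly a system of local
  coordinates (q, p) that lifts each point to \<open>Y\<close>, so existence and uniqueness reduce
  to the results on lifts.\<close>

lemma canonical_coordinate_system_of_isomorphism:
  fixes V :: "'N::finite cotangent_point set"
  assumes P: "finite P"
    and V: "closedin (ztop (zariski cotangent_coords (cotangent (base P)))) V"
      "\<And>\<sigma>. bij \<sigma> \<Longrightarrow> permute_cotangent \<sigma> ` V = V"
    and iso: "isomorphism X (quotient_space
      (zariski cotangent_coords (cotangent (base P - Delta P) - V)) orbit) \<Phi>"
  shows "canonical_coordinate_system X \<Phi>"
proof -
  define Y where "Y = cotangent_point -` (cotangent (base P - Delta P) - V)"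
  have Y_iff: "b \<in> Y \<longleftrightarrow> fst b \<in> base P \<and> inj (\<lambda>j. fst b $ j) \<and> cotangent_point b \<notin> V" for b
    unfolding Y_def using in_base_minus_Delta_iff[of "fst b" P] by simp
  have "cotangent (base P - Delta P) - V = cotangent_point ` Y"
    unfolding Y_def by (auto elim: cotangent_pointE)
  note iso' = iso[unfolded this]
  \<comment> \<open>The set \<open>V\<close> is closed over the whole of \<open>base P\<close>, so
    its complement there is open first, and distinctness of the q_j is imposed afterwards as a
    Euclidean open condition.\<close>
  have "open Y"
  proof -
    have "(cotangent_point :: _ \<Rightarrow> 'N cotangent_point) -` cotangent (base P) = fst -` base P"
      by (intro set_eqI) simp
    then have 1: "open ((cotangent_point :: _ \<Rightarrow> 'N cotangent_point) -` cotangent (base P))"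
      by (simp add: open_vimage_fst open_base[OF P])
    have "openin (ztop (zariski cotangent_coords (cotangent (base P)))) (cotangent (base P) - V)"
      using V(1) by (simp add: closedin_def)
    from this 1 have "open (cotangent_point -` (cotangent (base P) - V))"
      by (rule zariski_open_imp_open)
    then have "open (cotangent_point -` (cotangent (base P) - V) \<inter> fst -` {q. inj (\<lambda>j. q $ j)})"
      by (intro open_Int open_vimage_fst open_distinct)
    moreover have "cotangent_point -` (cotangent (base P) - V) \<inter> fst -` {q. inj (\<lambda>j. q $ j)} = Y"
      by (intro set_eqI) (simp add: Y_iff conj_ac)
    ultimately show ?thesis by simp
  qed
  have permute_Y: "(permute \<sigma> (fst b), permute \<sigma> (snd b)) \<in> Y" if b: "b \<in> Y" and \<sigma>: "bij \<sigma>" for b \<sigma>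
  proof -
    have "cotangent_point (permute \<sigma> (fst b), permute \<sigma> (snd b)) \<notin> V"
    proof
      assume "cotangent_point (permute \<sigma> (fst b), permute \<sigma> (snd b)) \<in> V"
      then have "cotangent_point (permute \<sigma> (fst b), permute \<sigma> (snd b)) \<in> permute_cotangent \<sigma> ` V"
        using V(2)[OF \<sigma>] by simp
      then obtain y where y: "y \<in> V"
        "cotangent_point (permute \<sigma> (fst b), permute \<sigma> (snd b)) = permute_cotangent \<sigma> y"
        by blast
      have "V \<subseteq> cotangent (base P)" using closedin_subset[OF V(1)] by simp
      then obtain b' where b': "y = cotangent_point b'" using y(1) cotangent_pointE by blast
      \<comment> \<open>Invariance of \<open>V\<close> provides a preimage in \<open>V\<close> of
        the permuted point; injectivity of the action shows that this preimage is the point of b,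
        which lies outside \<open>V\<close>.\<close>
      have "permute \<sigma> u = permute \<sigma> v \<Longrightarrow> u = v" for u v :: "complex ^ 'N"
        unfolding permute_def vec_eq_iff using bij_is_surj[OF \<sigma>] by simp (metis surjD)
      then have "b = b'"
        using y(2) unfolding b' permute_cotangent_point[OF \<sigma>] cotangent_point_eq_iff
        by (intro prod_eqI) blast+
      then show False using b y(1) b' by (simp add: Y_iff)
    qed
    moreover have "inj (\<lambda>j. permute \<sigma> (fst b) $ j)"
      using inj_compose[of "\<lambda>j. fst b $ j" \<sigma>] b bij_is_inj[OF \<sigma>] by (simp add: permute_def Y_iff o_def)
    moreover have "permute \<sigma> (fst b) \<in> base P" using b by (simp add: Y_iff base_def permute_def)
    ultimately show ?thesis by (simp add: Y_iff)
  qed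
  obtain \<theta> where \<theta>: "symmetric_quotient X Y \<theta>"
    and \<Phi>: "\<And>b. b \<in> Y \<Longrightarrow> \<Phi> (\<theta> b) = orbit (cotangent_point b)"
    by (rule symmetric_quotient_of_isomorphism[OF iso' \<open>open Y\<close> _ permute_Y]) (auto simp: Y_iff)
  interpret symmetric_quotient X Y \<theta> by (rule \<theta>)
  \<comment> \<open>Membership in the orbit \<open>\<Phi> y\<close> makes (q y, p y) a permutation
    of some b in \<open>Y\<close> over y, and \<open>Y\<close> and \<open>\<theta>\<close> are
    invariant under permutations.\<close>
  have lift: "(q y, p y) \<in> Y \<and> \<theta> (q y, p y) = y"
    if chart: "canonical_chart X \<Phi> U q p" and y: "y \<in> U" for U q p y
  proof -
    have "y \<in> points X"
      using chart y openin_analytic_top_subset by (auto simp: canonical_chart_def local_coordinates_def)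
    then obtain b where b: "b \<in> Y" "y = \<theta> b" using image_theta by blast
    have "cotangent_point (q y, p y) \<in> orbit (cotangent_point b)"
      using chart y \<Phi>[OF b(1)] b(2) by (auto simp: canonical_chart_def cotangent_point_def)
    then obtain \<sigma> where \<sigma>: "bij \<sigma>" "(q y, p y) = (permute \<sigma> (fst b), permute \<sigma> (snd b))"
      unfolding orbit_cotangent_point by auto
    then show ?thesis
      using permute_Y[OF b(1) \<sigma>(1)] theta_eq_iff[OF b(1), of "(q y, p y)"] b(2) by auto
  qed
  have chart: "\<exists>U q p. x \<in> U \<and> canonical_chart X \<Phi> U q p" if "x \<in> points X" for x
  proof -
    obtain U q p where U: "x \<in> U" "local_coordinates X U q p"
      "\<forall>y\<in>U. (q y, p y) \<in> Y \<and> \<theta> (q y, p y) = y"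
      using local_coordinates_exist[OF \<open>x \<in> points X\<close>] by blast
    have "(q y, covec (p y)) \<in> \<Phi> y" if "y \<in> U" for y
      using U(3) that \<Phi>[of "(q y, p y)"] cotangent_point_in_orbit[of "(q y, p y)"]
      by (simp add: cotangent_point_def)
    then show ?thesis using U unfolding canonical_chart_def by blast
  qed
  have unique: "\<exists>\<sigma> W. bij \<sigma> \<and> openin (analytic_top X) W \<and> x \<in> W \<and> W \<subseteq> U \<inter> U' \<and>
      (\<forall>y\<in>W. q' y = permute \<sigma> (q y) \<and> p' y = permute \<sigma> (p y))"
    if "canonical_chart X \<Phi> U q p" "canonical_chart X \<Phi> U' q' p'" "x \<in> U \<inter> U'" for U q p U' q' p' x
  proof -
    have "local_coordinates X U q p" "local_coordinates X U' q' p'"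
      using that by (simp_all add: canonical_chart_def)
    from local_coordinates_unique[OF this lift[OF that(1)] lift[OF that(2)] that(3)]
    show ?thesis by simp
  qed
  show ?thesis
    unfolding canonical_coordinate_system_def
  proof (intro conjI allI impI ballI)
    show "\<exists>U q p. x \<in> U \<and> canonical_chart X \<Phi> U q p" if "x \<in> points X" for x
      using that by (rule chart)
  qed (elim conjE, rule unique)
qed

theorem corollary1p8:
  fixes n :: nat
    and t :: "nat \<Rightarrow> sphere"
    and \<V> :: sections
    and \<rho> :: "nat \<Rightarrow> nat \<Rightarrow> complex"
    and C :: "nat \<Rightarrow> complex ^ 3 ^ 3"
    and M :: "(sections \<times> operator) set fspace"
    and M0 :: "(sections \<times> operator) set set"
    and V :: "'N::finite cotangent_point set"
    and \<Phi> :: "(sections \<times> operator) set \<Rightarrow> 'N cotangent_point set"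
  assumes "n \<ge> 2"
    and "inj_on t {..n}" and "t 0 = None"
    and "vector_bundle cont \<V>"
    and "generic_eigenvalues 3 n \<rho>"
    and "\<forall>i\<le>n. \<forall>x. det (mat x - C i) = (\<Prod>k=1..3. x - \<rho> i k)"
    and "moduli_space n t \<V> C M"
    and "CARD('N) = 3 * n - 5" and "has_dim M (2 * CARD('N))"
    and "openin (ztop M) M0" and "ztop M closure_of M0 = points M"
    and "closedin (ztop (zariski cotangent_coords (cotangent (base (t ` {..n}))))) V"
    and "\<forall>\<sigma>. bij \<sigma> \<longrightarrow> permute_cotangent \<sigma> ` V = V"
    and "isomorphism (open_subspace M M0)
      (quotient_space
        (zariski cotangent_coords (cotangent (base (t ` {..n}) - Delta (t ` {..n})) - V)) orbit) \<Phi>"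
  shows "canonical_coordinate_system (open_subspace M M0) \<Phi>"
proof (rule canonical_coordinate_system_of_isomorphism)
  show "finite (t ` {..n})" by simp
  show "permute_cotangent \<sigma> ` V = V" if "bij \<sigma>" for \<sigma>
    using assms that by blast
qed fact+

end
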